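(* Let $T$ be a branching self-similar tree. Then the set $\mathcal{R}_T$ of rational homeomorphisms of $\partial T$ is a group under composition, and it is isomorphic to $\mathcal{R}_2$. Moreover, there is a homeomorphism $h\colon\partial T\to\{0,1\}^\omega$ such that $f\mapsto h\circ f\circ h^{-1}$ is a bijection from $\mathcal{R}_T$ onto $\mathcal{R}_2$; that is, the action of $\mathcal{R}_T$ on $\partial T$ is conjugate to the action of $\mathcal{R}_2$ on $\{0,1\}^\omega$.
   Context: A self-similar tree is a locally finite rooted tree $T$, identified with its vertex set, together with the following data. First, a partition of the vertices into finitely many types. Second, for every pair $u,v$ of vertices of the same type, a nonempty finite set $\mathrm{Mor}(u,v)$ of rooted tree isomorphisms $T_u\to T_v$, called morphisms, each sending vertices to vertices of the same type; here $T_v$ is the subtree consisting of $v$ and its descendants. The morphisms must satisfy three conditions: (a) $\varphi\in\mathrm{Mor}(u,v)$ implies $\varphi^{-1}\in\mathrm{Mor}(v,u)$; (b) $\varphi\in\mathrm{Mor}(u,v)$ and $\psi\in\mathrm{Mor}(v,w)$ imply $\psi\varphi\in\mathrm{Mor}(u,w)$; (c) if $\varphi\in\mathrm{Mor}(v,w)$ and $u\in T_v$, then the restriction of $\varphi$ to $T_u$ lies in $\mathrm{Mor}(u,\varphi(u))$. $T$ is branching if every vertex has at least two children. The boundary $\partial T$ is the space of infinite descending paths from the root. Its topology has as basis the sets $\partial T_v$ of paths passing through $v$. A morphism $\varphi\colon T_v\to T_w$ induces a homeomorphism $\varphi_*\colon\partial T_v\to\partial T_w$. For self-similar trees $T,T'$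 and a homeomorphism $f\colon\partial T\to\partial T'$, $f$ has equivalent restrictions at vertices $v,w$ of $T$ of the same type if there exist vertices $x,y$ of $T'$ of the same type and morphisms $\varphi\in\mathrm{Mor}(v,w)$, $\psi\in\mathrm{Mor}(x,y)$ such that $f(\partial T_v)\subseteq\partial T'_x$, $f(\partial T_w)\subseteq\partial T'_y$ and $f\circ\varphi_*=\psi_*\circ f$ on $\partial T_v$. This is an equivalence relation on vertices, and $f$ is rational if it has only finitely many equivalence classes. $\mathcal{R}_2$ is the group of all homeomorphisms of $\{0,1\}^\omega$ computed by nondegenerate asynchronous finite-state transducers. Such a transducer has finitely many states and outputs a finite, possibly empty, binary word for each input letter read; nondegenerate means the total output is infinite on every infinite input. *)

theory Defs
  imports "HOL-Analysis.Abstract_Topology" "HOL-Algebra.Group" "HOL-Library.FuncSet"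
begin

text \<open>A rooted tree is a set T of finite words containing the empty word (the root)
 and closed under taking prefixes; the children of w are the words w @ [a] in T.
 Every locally finite rooted tree is isomorphic to such a tree.\<close>

definition rooted_tree :: "'a list set \<Rightarrow> bool" where
  "rooted_tree T \<longleftrightarrow> [] \<in> T \<and> (\<forall>w a. w @ [a] \<in> T \<longrightarrow> w \<in> T)"

definition locally_finite :: "'a list set \<Rightarrow> bool" where
  "locally_finite T \<longleftrightarrow> (\<forall>w\<in>T. finite {a. w @ [a] \<in> T})"

definition branching :: "'a list set \<Rightarrow> bool" where
  "branching T \<longleftrightarrow> (\<forall>w\<in>T. \<exists>a b. a \<noteq> b \<and> w @ [a] \<in> T \<and> w @ [b] \<in> T)"

definition is_child :: "'a list \<Rightarrow> 'a list \<Rightarrow> bool" where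
  "is_child w w' \<longleftrightarrow> (\<exists>a. w' = w @ [a])"

definition subtree :: "'a list set \<Rightarrow> 'a list \<Rightarrow> 'a list set" where
  "subtree T v = {w \<in> T. \<exists>z. w = v @ z}"

text \<open>Rooted tree isomorphisms T_u \<rightarrow> T_v that preserve the types; they are taken
 extensional (undefined outside T_u) so that equality of morphisms is equality on T_u.\<close>
definition tree_morphism ::
  "'a list set \<Rightarrow> ('a list \<Rightarrow> nat) \<Rightarrow> 'a list \<Rightarrow> 'a list \<Rightarrow> ('a list \<Rightarrow> 'a list) \<Rightarrow> bool" where
  "tree_morphism T tp u v \<phi> \<longleftrightarrow>
     \<phi> \<in> extensional (subtree T u) \<and>
     bij_betw \<phi> (subtree T u) (subtree T v) \<and> \<phi> u = v \<and>
     (\<forall>w\<in>subtree T u. \<forall>w'\<in>subtree T u. is_child w w' \<longleftrightarrow> is_child (\<phi> w) (\<phi> w')) \<and>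
     (\<forall>w\<in>subtree T u. tp (\<phi> w) = tp w)"

definition self_similar ::
  "'a list set \<Rightarrow> ('a list \<Rightarrow> nat) \<Rightarrow> ('a list \<Rightarrow> 'a list \<Rightarrow> ('a list \<Rightarrow> 'a list) set) \<Rightarrow> bool" where
  "self_similar T tp Mor \<longleftrightarrow>
     rooted_tree T \<and> locally_finite T \<and> finite (tp ` T) \<and>
     (\<forall>u\<in>T. \<forall>v\<in>T. tp u = tp v \<longrightarrow>
        finite (Mor u v) \<and> Mor u v \<noteq> {} \<and> (\<forall>\<phi>\<in>Mor u v. tree_morphism T tp u v \<phi>)) \<and>
     (\<forall>u\<in>T. \<forall>v\<in>T. tp u = tp v \<longrightarrow> (\<forall>\<phi>\<in>Mor u v.
        restrict (inv_into (subtree T u) \<phi>) (subtree T v) \<in> Mor v u)) \<and>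
     (\<forall>u\<in>T. \<forall>v\<in>T. \<forall>w\<in>T. tp u = tp v \<longrightarrow> tp v = tp w \<longrightarrow>
        (\<forall>\<phi>\<in>Mor u v. \<forall>\<psi>\<in>Mor v w. restrict (\<psi> \<circ> \<phi>) (subtree T u) \<in> Mor u w)) \<and>
     (\<forall>v\<in>T. \<forall>w\<in>T. tp v = tp w \<longrightarrow> (\<forall>\<phi>\<in>Mor v w. \<forall>u\<in>subtree T v.
        restrict \<phi> (subtree T u) \<in> Mor u (\<phi> u)))"

definition pref :: "(nat \<Rightarrow> 'a) \<Rightarrow> nat \<Rightarrow> 'a list" where
  "pref x n = map x [0..<n]"

definition bdry :: "'a list set \<Rightarrow> (nat \<Rightarrow> 'a) set" where
  "bdry T = {x. \<forall>n. pref x n \<in> T}"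

definition cyl :: "'a list set \<Rightarrow> 'a list \<Rightarrow> (nat \<Rightarrow> 'a) set" where
  "cyl T v = {x \<in> bdry T. pref x (length v) = v}"

definition bdry_top :: "'a list set \<Rightarrow> (nat \<Rightarrow> 'a) topology" where
  "bdry_top T = topology_generated_by {cyl T v | v. v \<in> T}"

text \<open>The homeomorphism \<partial>T_v \<rightarrow> \<partial>T_w induced by a morphism \<phi> : T_v \<rightarrow> T_w:
 the k-th letter of the image path is the k-th letter of the image of the vertex
 of depth |v|+k+1 on the path.\<close>
definition induced :: "('a list \<Rightarrow> 'a list) \<Rightarrow> 'a list \<Rightarrow> (nat \<Rightarrow> 'a) \<Rightarrow> (nat \<Rightarrow> 'a)" where
  "induced \<phi> v x = (\<lambda>k. \<phi> (pref x (length v + Suc k)) ! k)"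

definition equiv_restr ::
  "'a list set \<Rightarrow> ('a list \<Rightarrow> nat) \<Rightarrow> ('a list \<Rightarrow> 'a list \<Rightarrow> ('a list \<Rightarrow> 'a list) set) \<Rightarrow>
   'b list set \<Rightarrow> ('b list \<Rightarrow> nat) \<Rightarrow> ('b list \<Rightarrow> 'b list \<Rightarrow> ('b list \<Rightarrow> 'b list) set) \<Rightarrow>
   ((nat \<Rightarrow> 'a) \<Rightarrow> (nat \<Rightarrow> 'b)) \<Rightarrow> 'a list \<Rightarrow> 'a list \<Rightarrow> bool" where
  "equiv_restr T tp Mor T' tp' Mor' f v w \<longleftrightarrow>
     (\<exists>x\<in>T'. \<exists>y\<in>T'. \<exists>\<phi>\<in>Mor v w. \<exists>\<psi>\<in>Mor' x y. tp' x = tp' y \<and>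
        f ` cyl T v \<subseteq> cyl T' x \<and> f ` cyl T w \<subseteq> cyl T' y \<and>
        (\<forall>p\<in>cyl T v. f (induced \<phi> v p) = induced \<psi> x (f p)))"

definition rational ::
  "'a list set \<Rightarrow> ('a list \<Rightarrow> nat) \<Rightarrow> ('a list \<Rightarrow> 'a list \<Rightarrow> ('a list \<Rightarrow> 'a list) set) \<Rightarrow>
   'b list set \<Rightarrow> ('b list \<Rightarrow> nat) \<Rightarrow> ('b list \<Rightarrow> 'b list \<Rightarrow> ('b list \<Rightarrow> 'b list) set) \<Rightarrow>
   ((nat \<Rightarrow> 'a) \<Rightarrow> (nat \<Rightarrow> 'b)) \<Rightarrow> bool" where
  "rational T tp Mor T' tp' Mor' f \<longleftrightarrow>
     finite (T // {(v, w). v \<in> T \<and> w \<in> T \<and> tp v = tp w \<and> equiv_restr T tp Mor T' tp' Mor' f v w})"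

definition RT :: "'a list set \<Rightarrow> ('a list \<Rightarrow> nat) \<Rightarrow> ('a list \<Rightarrow> 'a list \<Rightarrow> ('a list \<Rightarrow> 'a list) set)
    \<Rightarrow> ((nat \<Rightarrow> 'a) \<Rightarrow> (nat \<Rightarrow> 'a)) set" where
  "RT T tp Mor = {f \<in> extensional (bdry T).
      homeomorphic_map (bdry_top T) (bdry_top T) f \<and> rational T tp Mor T tp Mor f}"

definition RT_group :: "'a list set \<Rightarrow> ('a list \<Rightarrow> nat) \<Rightarrow> ('a list \<Rightarrow> 'a list \<Rightarrow> ('a list \<Rightarrow> 'a list) set)
    \<Rightarrow> ((nat \<Rightarrow> 'a) \<Rightarrow> (nat \<Rightarrow> 'a)) monoid" where
  "RT_group T tp Mor = \<lparr>carrier = RT T tp Mor, mult = (\<lambda>f g. compose (bdry T) f g),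
      one = restrict id (bdry T)\<rparr>"

definition cantor_top :: "(nat \<Rightarrow> bool) topology" where
  "cantor_top = bdry_top (UNIV :: bool list set)"

text \<open>Asynchronous finite-state transducers: finite state set Q \<subseteq> nat, initial state q0,
 transition function \<delta>, output function out (a possibly empty binary word per letter).\<close>
fun trun :: "(nat \<Rightarrow> bool \<Rightarrow> nat) \<Rightarrow> nat \<Rightarrow> (nat \<Rightarrow> bool) \<Rightarrow> nat \<Rightarrow> nat" where
  "trun \<delta> q0 x 0 = q0"
| "trun \<delta> q0 x (Suc n) = \<delta> (trun \<delta> q0 x n) (x n)"

definition tout :: "(nat \<Rightarrow> bool \<Rightarrow> nat) \<Rightarrow> (nat \<Rightarrow> bool \<Rightarrow> bool list) \<Rightarrow> nat \<Rightarrow> (nat \<Rightarrow> bool) \<Rightarrow> nat \<Rightarrow> bool list" where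
  "tout \<delta> out q0 x n = concat (map (\<lambda>i. out (trun \<delta> q0 x i) (x i)) [0..<n])"

definition transducer :: "nat set \<Rightarrow> nat \<Rightarrow> (nat \<Rightarrow> bool \<Rightarrow> nat) \<Rightarrow> bool" where
  "transducer Q q0 \<delta> \<longleftrightarrow> finite Q \<and> q0 \<in> Q \<and> (\<forall>q\<in>Q. \<forall>b. \<delta> q b \<in> Q)"

definition nondegenerate :: "(nat \<Rightarrow> bool \<Rightarrow> nat) \<Rightarrow> (nat \<Rightarrow> bool \<Rightarrow> bool list) \<Rightarrow> nat \<Rightarrow> bool" where
  "nondegenerate \<delta> out q0 \<longleftrightarrow> (\<forall>x m. \<exists>n. m \<le> length (tout \<delta> out q0 x n))"

definition computes :: "(nat \<Rightarrow> bool \<Rightarrow> nat) \<Rightarrow> (nat \<Rightarrow> bool \<Rightarrow> bool list) \<Rightarrow> nat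
    \<Rightarrow> ((nat \<Rightarrow> bool) \<Rightarrow> (nat \<Rightarrow> bool)) \<Rightarrow> bool" where
  "computes \<delta> out q0 f \<longleftrightarrow>
     (\<forall>x n i. i < length (tout \<delta> out q0 x n) \<longrightarrow> f x i = tout \<delta> out q0 x n ! i)"

definition R2 :: "((nat \<Rightarrow> bool) \<Rightarrow> (nat \<Rightarrow> bool)) set" where
  "R2 = {f. homeomorphic_map cantor_top cantor_top f \<and>
           (\<exists>Q q0 \<delta> out. transducer Q q0 \<delta> \<and> nondegenerate \<delta> out q0 \<and> computes \<delta> out q0 f)}"

definition R2_group :: "((nat \<Rightarrow> bool) \<Rightarrow> (nat \<Rightarrow> bool)) monoid" where
  "R2_group = \<lparr>carrier = R2, mult = (\<circ>), one = id\<rparr>"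

end

theory Submission
  imports Defs
begin

text \<open>Call \<open>f\<close> finitary if finitely many vertices represent all its classes of equivalent
  restrictions. Finitary homeomorphisms between boundaries of branching self-similar trees are
  closed under composition (because the sets of morphisms are finite) and under inversion (by
  Koenig's lemma). On the binary tree with its prefix replacements as morphisms they are exactly
  the maps computed by transducers: the states are the local actions of the map. Finally, coding the
  children of one representative vertex per type by a complete prefix code yields a finitary
  homeomorphism \<open>h\<close> from any boundary to the Cantor space, and conjugation by \<open>h\<close> identifies the two
  groups.\<close>

section \<open>Boundaries and cylinders\<close>

text \<open>Two obstacles shape the proof. In the definition of equivalent restrictions the target
  vertices \<open>x\<close>, \<open>y\<close> are any vertices whose cylinders contain the images,
  so a class does not determine them. And for a composition, the morphism that \<open>f\<close>
  produces in the middle tree would have to coincide with the one that \<open>g\<close> starts from,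
  although the two are chosen independently. Branching removes the first obstacle: the image of a
  cylinder under an injective map contains two points, hence lies in only finitely many cylinders.
  Finiteness of the sets of morphisms removes the second: the discrepancy between the two choices
  takes finitely many values and can be made part of an invariant of the vertex. Replacing morphisms
  by the boundary maps that they induce puts the binary tree under the same axioms, so conjugation
  by \<open>h\<close> is just composition of finitary maps between different trees.\<close>

lemma length_pref [simp]: "length (pref x n) = n"
  by (simp add: pref_def)

lemma nth_pref [simp]: "i < n \<Longrightarrow> pref x n ! i = x i"
  by (simp add: pref_def)

lemma pref_0 [simp]: "pref x 0 = []"
  by (simp add: pref_def)

lemma pref_Suc: "pref x (Suc n) = pref x n @ [x n]"
  by (simp add: pref_def)

lemma pref_eq_iff: "pref x n = pref y n \<longleftrightarrow> (\<forall>i<n. x i = y i)"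
  by (auto simp: list_eq_iff_nth_eq)

lemma pref_eq_list_iff: "pref x (length v) = v \<longleftrightarrow> (\<forall>i<length v. x i = v ! i)"
  by (auto simp: list_eq_iff_nth_eq)

lemma pref_le: "m \<le> n \<Longrightarrow> \<exists>z. pref x n = pref x m @ z"
  unfolding pref_def using upt_add_eq_append[of 0 m "n - m"] by auto

lemma pref_append_eq: "pref x (length (v @ z)) = v @ z \<Longrightarrow> pref x (length v) = v"
  unfolding pref_eq_list_iff by (metis length_append nth_append trans_less_add1)

lemma rooted_prefix: "rooted_tree T \<Longrightarrow> v @ z \<in> T \<Longrightarrow> v \<in> T"
  by (induction z rule: rev_induct) (auto simp: rooted_tree_def simp flip: append_assoc)

lemma mem_cyl_iff: "p \<in> cyl T v \<longleftrightarrow> p \<in> bdry T \<and> (\<forall>i<length v. p i = v ! i)"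
  by (simp add: cyl_def pref_eq_list_iff)

lemma cyl_subset_bdry: "cyl T v \<subseteq> bdry T"
  by (auto simp: cyl_def)

lemma cyl_Nil [simp]: "cyl T [] = bdry T"
  by (auto simp: cyl_def)

lemma cyl_append_subset: "cyl T (v @ z) \<subseteq> cyl T v"
  unfolding cyl_def using pref_append_eq by auto

lemma mem_cyl_pref: "p \<in> bdry T \<Longrightarrow> p \<in> cyl T (pref p n)"
  by (auto simp: cyl_def)

lemma cyl_in_tree: "p \<in> cyl T v \<Longrightarrow> v \<in> T"
  unfolding cyl_def bdry_def by (metis (mono_tags, lifting) mem_Collect_eq)

lemma cyl_pref_antimono: "m \<le> n \<Longrightarrow> cyl T (pref p n) \<subseteq> cyl T (pref p m)"
  by (metis pref_le cyl_append_subset)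

lemma cyl_nbhd: "\<forall>p\<in>cyl T v. \<exists>n. cyl T (pref p n) \<subseteq> cyl T v"
  by (metis (mono_tags, lifting) cyl_def mem_Collect_eq order_refl)

lemma cyl_UNIV_iff: "p \<in> cyl UNIV v \<longleftrightarrow> pref p (length v) = v"
  by (simp add: cyl_def bdry_def)

lemma cyl_comparable:
  assumes "p \<in> cyl T x" "p \<in> cyl T y"
  shows "(\<exists>z. y = x @ z) \<or> (\<exists>z. x = y @ z)"
proof -
  have p: "pref p (length x) = x" "pref p (length y) = y"
    using assms by (auto simp: cyl_def)
  show ?thesis
    using pref_le[of "length x" "length y" p] pref_le[of "length y" "length x" p]
    unfolding p by (metis nat_le_linear)
qed

text \<open>Letter \<open>k\<close> of the limit path is already settled in
  \<open>g (Suc k)\<close>, whose length exceeds \<open>k\<close>. The diagonal has the form of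
  \<open>induced\<close>, so the lemma serves both to build paths and to compute with induced
  maps.\<close>

lemma pref_chain:
  assumes "\<And>n. \<exists>a. g (Suc n) = g n @ [a]"
  shows "pref (\<lambda>k. g (Suc k) ! k) (length (g 0) + n) = g n"
proof -
  have len: "length (g n) = length (g 0) + n" for n
  proof (induction n)
    case (Suc n)
    then show ?case using assms[of n] by auto
  qed simp
  have app: "\<exists>z. g (m + k) = g m @ z" for m k
  proof (induction k)
    case (Suc k)
    then show ?case using assms[of "m + k"] by auto
  qed simp
  have nth: "g (Suc k) ! k = g n ! k" if "k < length (g 0) + n" for k
  proof (cases "Suc k \<le> n")
    case True
    then obtain z where "g n = g (Suc k) @ z" using app[of "Suc k" "n - Suc k"] by auto
    then show ?thesis using len[of "Suc k"] by (simp add: nth_append)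
  next
    case False
    then obtain z where "g (Suc k) = g n @ z" using app[of n "Suc k - n"] by auto
    then show ?thesis using len[of n] that by (simp add: nth_append)
  qed
  show ?thesis
    by (rule nth_equalityI) (auto simp: len[of n] nth)
qed

lemma path_extend:
  assumes "P v" and step: "\<And>u. P u \<Longrightarrow> \<exists>a. P (u @ [a])"
  obtains p where "pref p (length v) = v" "\<And>n. length v \<le> n \<Longrightarrow> P (pref p n)"
proof -
  define g where "g = rec_nat v (\<lambda>_ u. u @ [SOME a. P (u @ [a])])"
  have g: "g 0 = v" "g (Suc n) = g n @ [SOME a. P (g n @ [a])]" for n
    by (simp_all add: g_def)
  have P: "P (g n)" for n
  proof (induction n)
    case (Suc n)
    then show ?case using step[OF Suc] g(2) by (metis someI_ex)
  qed (simp add: g assms)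
  have ch: "pref (\<lambda>k. g (Suc k) ! k) (length v + n) = g n" for n
    using pref_chain[of g n] g by auto
  show ?thesis
  proof (rule that)
    show "pref (\<lambda>k. g (Suc k) ! k) (length v) = v"
      using ch[of 0] g by simp
    show "P (pref (\<lambda>k. g (Suc k) ! k) n)" if "length v \<le> n" for n
      using ch[of "n - length v"] P[of "n - length v"] that by simp
  qed
qed

lemma bdryI:
  assumes "rooted_tree T" "\<And>n. m \<le> n \<Longrightarrow> pref p n \<in> T"
  shows "p \<in> bdry T"
  unfolding bdry_def using assms
  by (auto, metis le_cases pref_le rooted_prefix)

lemma Koenig:
  assumes T: "rooted_tree T" "locally_finite T"
    and S: "S \<subseteq> T" "infinite S" "\<And>u a. u @ [a] \<in> S \<Longrightarrow> u \<in> S"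
  obtains p where "p \<in> bdry T" "\<And>n. pref p n \<in> S"
proof -
  \<comment> \<open>A vertex with infinitely many elements of \<open>S\<close> below it has a child
    with the same property, because it has only finitely many children.\<close>
  define P where "P u \<longleftrightarrow> infinite {w \<in> S. \<exists>z. w = u @ z}" for u
  have S': "u \<in> S" if "u @ z \<in> S" for u z
    using that by (induction z rule: rev_induct) (auto simp: S simp flip: append_assoc)
  have PS: "u \<in> S" if "P u" for u
    using that S' not_finite_existsD unfolding P_def by fastforce
  have step: "\<exists>a. P (u @ [a])" if "P u" for u
  proof (rule ccontr)
    assume "\<nexists>a. P (u @ [a])"
    then have fin: "finite {w \<in> S. \<exists>z. w = (u @ [a]) @ z}" for a
      by (auto simp: P_def)
    have "finite {a. u @ [a] \<in> T}"
      using T(2) PS[OF that] S(1) by (auto simp: locally_finite_def)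
    moreover have "{w \<in> S. \<exists>z. w = u @ z} \<subseteq>
        insert u (\<Union>a\<in>{a. u @ [a] \<in> T}. {w \<in> S. \<exists>z. w = (u @ [a]) @ z})"
    proof clarsimp
      fix z assume z: "u @ z \<in> S" "\<forall>a. u @ [a] \<in> T \<longrightarrow> (\<forall>za. z \<noteq> a # za)"
      show "z = []"
      proof (cases z)
        case (Cons a z')
        then have "u @ [a] \<in> T"
          using z(1) S' [of "u @ [a]" z'] S(1) by auto
        then show ?thesis using z Cons by auto
      qed
    qed
    ultimately have "finite {w \<in> S. \<exists>z. w = u @ z}"
      using fin by (meson finite_UN_I finite_insert finite_subset)
    then show False using that P_def by auto
  qed
  have "P []" using S by (simp add: P_def)
  then obtain p where p: "\<And>n. length ([]::'a list) \<le> n \<Longrightarrow> P (pref p n)"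
    using path_extend[of P "[]"] step by metis
  show ?thesis
  proof (rule that)
    show "pref p n \<in> S" for n using p PS by simp
    then show "p \<in> bdry T" using S(1) by (auto simp: bdry_def)
  qed
qed

lemma cyl_nonempty:
  assumes "rooted_tree T" "branching T" "v \<in> T"
  obtains p where "p \<in> cyl T v"
proof -
  have "\<exists>a. u @ [a] \<in> T" if "u \<in> T" for u
    using assms(2) that by (auto simp: branching_def)
  then obtain p where "pref p (length v) = v" "\<And>n. length v \<le> n \<Longrightarrow> pref p n \<in> T"
    using path_extend[of "\<lambda>u. u \<in> T" v] assms(3) by metis
  then show ?thesis
    using that[of p] bdryI[OF assms(1), of "length v" p] by (auto simp: cyl_def)
qed

text \<open>This is how branching makes a cylinder determine its vertex: the two points part right
  after \<open>v\<close>, so every cylinder containing both belongs to a prefix of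
  \<open>v\<close>.\<close>

lemma cyl_two_points:
  assumes "rooted_tree T" "branching T" "v \<in> T"
  obtains p q where "p \<in> cyl T v" "q \<in> cyl T v" "p (length v) \<noteq> q (length v)"
proof -
  obtain a b where ab: "a \<noteq> b" "v @ [a] \<in> T" "v @ [b] \<in> T"
    using assms by (auto simp: branching_def)
  obtain p where p: "p \<in> cyl T (v @ [a])" using cyl_nonempty assms ab by metis
  obtain q where q: "q \<in> cyl T (v @ [b])" using cyl_nonempty assms ab by metis
  show ?thesis
  proof (rule that)
    show "p \<in> cyl T v" "q \<in> cyl T v" using p q cyl_append_subset by auto
    show "p (length v) \<noteq> q (length v)" using p q ab(1) by (auto simp: mem_cyl_iff)
  qed
qed

lemma cyl_subset_imp_append:
  assumes "rooted_tree T" "branching T" "x \<in> T" "cyl T x \<subseteq> cyl T y"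
  obtains z where "x = y @ z"
proof -
  obtain p q where pq: "p \<in> cyl T x" "q \<in> cyl T x" "p (length x) \<noteq> q (length x)"
    using cyl_two_points assms by metis
  then have pqy: "p \<in> cyl T y" "q \<in> cyl T y" using assms by auto
  have "length y \<le> length x"
  proof (rule ccontr)
    assume "\<not> length y \<le> length x"
    then show False using pqy pq(3) by (auto simp: mem_cyl_iff)
  qed
  then show ?thesis
    using that cyl_comparable[OF pq(1) pqy(1)] by auto
qed

text \<open>A vertex whose cylinder contains \<open>p\<close> and \<open>q\<close> is a prefix of
  \<open>p\<close>, of length at most \<open>n\<close> for any \<open>n\<close> with
  \<open>p n \<noteq> q n\<close>.\<close>

lemma finite_containing_cyl:
  assumes "p \<in> A" "q \<in> A" "p \<noteq> q"
  shows "finite {x. A \<subseteq> cyl T x}"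
proof -
  obtain n where n: "p n \<noteq> q n" using assms(3) by auto
  have "{x. A \<subseteq> cyl T x} \<subseteq> pref p ` {..n}"
  proof
    fix x assume "x \<in> {x. A \<subseteq> cyl T x}"
    then have x: "p \<in> cyl T x" "q \<in> cyl T x" using assms by auto
    then have "length x \<le> n" using n unfolding mem_cyl_iff by (metis not_le_imp_less)
    then show "x \<in> pref p ` {..n}" using x(1) by (force simp: cyl_def)
  qed
  then show ?thesis by (rule finite_subset) simp
qed

text \<open>Bounds the choice of a target vertex for a given source vertex; injectivity keeps two
  points of the cylinder apart.\<close>

lemma finite_containing_cyl_image:
  assumes "rooted_tree T" "branching T" "v \<in> T" "inj_on f (bdry T)"
  shows "finite {x. f ` cyl T v \<subseteq> cyl T' x}"
proof -
  obtain p q where pq: "p \<in> cyl T v" "q \<in> cyl T v" "p (length v) \<noteq> q (length v)"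
    using cyl_two_points assms by metis
  then have "f p \<noteq> f q"
    using assms(4) cyl_subset_bdry by (metis inj_onD subsetD)
  then show ?thesis using pq by (intro finite_containing_cyl[of "f p" _ "f q"]) auto
qed

section \<open>Topology\<close>

text \<open>Continuity in terms of prefixes, so that abstract topologies occur only where the given
  definitions are translated.\<close>

definition cyl_cont :: "'a list set \<Rightarrow> 'b list set \<Rightarrow> ((nat \<Rightarrow> 'a) \<Rightarrow> (nat \<Rightarrow> 'b)) \<Rightarrow> bool" where
  "cyl_cont T T' f \<longleftrightarrow> (\<forall>p\<in>bdry T. \<forall>n. \<exists>m. f ` cyl T (pref p m) \<subseteq> cyl T' (pref (f p) n))"

lemma topspace_bdry_top: "rooted_tree T \<Longrightarrow> topspace (bdry_top T) = bdry T"
  unfolding bdry_top_def topology_generated_by_topspace rooted_tree_def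
  using cyl_subset_bdry by fastforce

lemma openin_bdry_top_iff:
  "openin (bdry_top T) U \<longleftrightarrow> U \<subseteq> bdry T \<and> (\<forall>p\<in>U. \<exists>n. cyl T (pref p n) \<subseteq> U)"
proof
  assume "openin (bdry_top T) U"
  then have "generate_topology_on {cyl T v |v. v \<in> T} U"
    by (simp add: bdry_top_def openin_topology_generated_by_iff)
  then show "U \<subseteq> bdry T \<and> (\<forall>p\<in>U. \<exists>n. cyl T (pref p n) \<subseteq> U)"
  proof induction
    case (Int A B)
    show ?case
    proof (intro conjI ballI)
      show "A \<inter> B \<subseteq> bdry T" using Int by auto
      fix p assume "p \<in> A \<inter> B"
      then obtain m n where "cyl T (pref p m) \<subseteq> A" "cyl T (pref p n) \<subseteq> B"
        using Int by blast
      then have "cyl T (pref p (max m n)) \<subseteq> A \<inter> B"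
        using cyl_pref_antimono[of m "max m n" T p] cyl_pref_antimono[of n "max m n" T p] by auto
      then show "\<exists>n. cyl T (pref p n) \<subseteq> A \<inter> B" by blast
    qed
  next
    case (UN K)
    then show ?case by (meson Union_iff Sup_upper Sup_least order_trans)
  next
    case (Basis s)
    then obtain v where v: "s = cyl T v" by auto
    then show ?case by (simp add: cyl_nbhd cyl_subset_bdry)
  qed auto
next
  assume U: "U \<subseteq> bdry T \<and> (\<forall>p\<in>U. \<exists>n. cyl T (pref p n) \<subseteq> U)"
  have "openin (bdry_top T) (\<Union>{cyl T v |v. v \<in> T \<and> cyl T v \<subseteq> U})"
    by (rule openin_Union) (auto simp: bdry_top_def intro: topology_generated_by_Basis)
  moreover have "\<Union>{cyl T v |v. v \<in> T \<and> cyl T v \<subseteq> U} = U"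
  proof
    show "U \<subseteq> \<Union>{cyl T v |v. v \<in> T \<and> cyl T v \<subseteq> U}"
    proof
      fix p assume p: "p \<in> U"
      then obtain n where n: "cyl T (pref p n) \<subseteq> U" using U by blast
      have pc: "p \<in> cyl T (pref p n)" using p U by (auto intro: mem_cyl_pref)
      then show "p \<in> \<Union>{cyl T v |v. v \<in> T \<and> cyl T v \<subseteq> U}"
        using n cyl_in_tree[OF pc] by blast
    qed
  qed auto
  ultimately show "openin (bdry_top T) U" by simp
qed

lemma continuous_map_bdry_iff:
  assumes "rooted_tree T" "rooted_tree T'"
  shows "continuous_map (bdry_top T) (bdry_top T') f \<longleftrightarrow>
    f ` bdry T \<subseteq> bdry T' \<and> cyl_cont T T' f"
proof (intro iffI conjI)
  assume L: "continuous_map (bdry_top T) (bdry_top T') f"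
  then show img: "f ` bdry T \<subseteq> bdry T'"
    using continuous_map_image_subset_topspace topspace_bdry_top assms by metis
  show "cyl_cont T T' f"
    unfolding cyl_cont_def
  proof (intro ballI allI)
    fix p n assume p: "p \<in> bdry T"
    then have "f p \<in> cyl T' (pref (f p) n)" using img by (auto intro: mem_cyl_pref)
    moreover have "openin (bdry_top T') (cyl T' (pref (f p) n))"
      unfolding openin_bdry_top_iff by (simp add: cyl_nbhd cyl_subset_bdry)
    then have "openin (bdry_top T) {q \<in> topspace (bdry_top T). f q \<in> cyl T' (pref (f p) n)}"
      using L openin_continuous_map_preimage by blast
    ultimately have "\<exists>m. cyl T (pref p m) \<subseteq> {q \<in> bdry T. f q \<in> cyl T' (pref (f p) n)}"
      using p unfolding openin_bdry_top_iff by (simp add: topspace_bdry_top assms)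
    then show "\<exists>m. f ` cyl T (pref p m) \<subseteq> cyl T' (pref (f p) n)" by blast
  qed
next
  assume R: "f ` bdry T \<subseteq> bdry T' \<and> cyl_cont T T' f"
  show "continuous_map (bdry_top T) (bdry_top T') f"
    unfolding continuous_map_def
  proof (intro conjI allI impI)
    show "f \<in> topspace (bdry_top T) \<rightarrow> topspace (bdry_top T')"
      using R by (auto simp: topspace_bdry_top assms)
    fix U assume "openin (bdry_top T') U"
    then have U: "\<exists>n. cyl T' (pref p n) \<subseteq> U" if "p \<in> U" for p
      using that openin_bdry_top_iff by blast
    show "openin (bdry_top T) {x \<in> topspace (bdry_top T). f x \<in> U}"
      unfolding openin_bdry_top_iff
    proof (intro conjI ballI)
      fix p assume "p \<in> {x \<in> topspace (bdry_top T). f x \<in> U}"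
      then have p: "p \<in> bdry T" "f p \<in> U" by (auto simp: topspace_bdry_top assms)
      obtain n where "cyl T' (pref (f p) n) \<subseteq> U" using U p by blast
      moreover obtain m where "f ` cyl T (pref p m) \<subseteq> cyl T' (pref (f p) n)"
        using R p unfolding cyl_cont_def by blast
      ultimately have "cyl T (pref p m) \<subseteq> {x \<in> topspace (bdry_top T). f x \<in> U}"
        using cyl_subset_bdry[of T "pref p m"] by (auto simp: topspace_bdry_top assms)
      then show "\<exists>n. cyl T (pref p n) \<subseteq> {x \<in> topspace (bdry_top T). f x \<in> U}" by blast
    qed (auto simp: topspace_bdry_top assms)
  qed
qed

text \<open>The inverse is an explicit argument and both directions enter alike, so passing to the
  inverse is immediate. Values off the boundaries are left free.\<close>

definition cyl_homeo ::
  "'a list set \<Rightarrow> 'b list set \<Rightarrow> ((nat \<Rightarrow> 'a) \<Rightarrow> (nat \<Rightarrow> 'b)) \<Rightarrow> ((nat \<Rightarrow> 'b) \<Rightarrow> (nat \<Rightarrow> 'a)) \<Rightarrow> bool" where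
  "cyl_homeo T T' f g \<longleftrightarrow>
     f ` bdry T \<subseteq> bdry T' \<and> g ` bdry T' \<subseteq> bdry T \<and>
     (\<forall>p\<in>bdry T. g (f p) = p) \<and> (\<forall>q\<in>bdry T'. f (g q) = q) \<and>
     cyl_cont T T' f \<and> cyl_cont T' T g"

lemma homeomorphic_maps_bdry_iff:
  assumes "rooted_tree T" "rooted_tree T'"
  shows "homeomorphic_maps (bdry_top T) (bdry_top T') f g \<longleftrightarrow> cyl_homeo T T' f g"
  unfolding homeomorphic_maps_def cyl_homeo_def
  by (auto simp: continuous_map_bdry_iff assms topspace_bdry_top)

lemma homeomorphic_map_bdry_iff:
  assumes "rooted_tree T" "rooted_tree T'"
  shows "homeomorphic_map (bdry_top T) (bdry_top T') f \<longleftrightarrow> (\<exists>g. cyl_homeo T T' f g)"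
  unfolding homeomorphic_map_maps homeomorphic_maps_bdry_iff[OF assms] ..

lemma cyl_homeo_sym: "cyl_homeo T T' f g \<Longrightarrow> cyl_homeo T' T g f"
  by (auto simp: cyl_homeo_def)

lemma cyl_homeo_inj_on: "cyl_homeo T T' f g \<Longrightarrow> inj_on f (bdry T)"
  unfolding cyl_homeo_def by (rule inj_on_inverseI[of _ g]) auto

lemma cyl_homeo_id: "cyl_homeo T T (\<lambda>p. p) (\<lambda>p. p)"
  by (auto simp: cyl_homeo_def cyl_cont_def)

lemma cyl_cont_comp:
  assumes "cyl_cont T T' f" "cyl_cont T' T'' g" "f ` bdry T \<subseteq> bdry T'"
  shows "cyl_cont T T'' (\<lambda>p. g (f p))"
  unfolding cyl_cont_def
proof (intro ballI allI)
  fix p n assume p: "p \<in> bdry T"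
  then obtain m where m: "g ` cyl T' (pref (f p) m) \<subseteq> cyl T'' (pref (g (f p)) n)"
    using assms unfolding cyl_cont_def by blast
  obtain k where "f ` cyl T (pref p k) \<subseteq> cyl T' (pref (f p) m)"
    using assms p unfolding cyl_cont_def by blast
  then show "\<exists>m. (\<lambda>p. g (f p)) ` cyl T (pref p m) \<subseteq> cyl T'' (pref (g (f p)) n)"
    using m by blast
qed

lemma cyl_homeo_comp:
  assumes "cyl_homeo T T' f f'" "cyl_homeo T' T'' g g'"
  shows "cyl_homeo T T'' (\<lambda>p. g (f p)) (\<lambda>p. f' (g' p))"
  using assms cyl_cont_comp[of T T' f T'' g] cyl_cont_comp[of T'' T' g' T f']
  by (auto simp: cyl_homeo_def image_subset_iff)

lemma cyl_cont_cong:
  assumes "cyl_cont T T' f" "\<And>p. p \<in> bdry T \<Longrightarrow> f' p = f p"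
  shows "cyl_cont T T' f'"
proof -
  have "f' ` cyl T v = f ` cyl T v" for v
    using assms(2) cyl_subset_bdry by (metis (no_types, lifting) image_cong subsetD)
  then show ?thesis using assms unfolding cyl_cont_def by simp
qed

lemma cyl_homeo_cong:
  assumes "cyl_homeo T T' f g" "\<And>p. p \<in> bdry T \<Longrightarrow> f' p = f p" "\<And>p. p \<in> bdry T' \<Longrightarrow> g' p = g p"
  shows "cyl_homeo T T' f' g'"
  using assms cyl_cont_cong[of T T' f f'] cyl_cont_cong[of T' T g g']
  by (auto simp: cyl_homeo_def image_subset_iff)

section \<open>Self-similar structures on the boundary\<close>

text \<open>Here \<open>mor u v e\<close> says that \<open>e\<close> agrees on the cylinder of \<open>u\<close> with a map induced by a
  morphism from \<open>u\<close> to \<open>v\<close>; the values of \<open>e\<close> elsewhere are irrelevant. Types are only present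
  through \<open>fin_reps\<close>.\<close>

locale tree_structure =
  fixes T :: "'a list set"
    and mor :: "'a list \<Rightarrow> 'a list \<Rightarrow> ((nat \<Rightarrow> 'a) \<Rightarrow> (nat \<Rightarrow> 'a)) \<Rightarrow> bool"
  assumes rooted: "rooted_tree T"
    and locfin: "locally_finite T"
    and branch: "branching T"
    and fin_reps: "\<exists>R. finite R \<and> R \<subseteq> T \<and> (\<forall>v\<in>T. \<exists>r\<in>R. \<exists>e. mor v r e)"
    and mor_in: "mor u v e \<Longrightarrow> u \<in> T \<and> v \<in> T"
    and mor_bij: "mor u v e \<Longrightarrow> bij_betw e (cyl T u) (cyl T v)"
    and mor_cong: "mor u v e \<Longrightarrow> (\<And>p. p \<in> cyl T u \<Longrightarrow> e' p = e p) \<Longrightarrow> mor u v e'"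
    and mor_fin: "finite ((\<lambda>e. restrict e (cyl T u)) ` {e. mor u v e})"
    and mor_comp: "mor u v e \<Longrightarrow> mor v w d \<Longrightarrow> mor u w (\<lambda>p. d (e p))"
    and mor_inv: "mor u v e \<Longrightarrow> mor v u (inv_into (cyl T u) e)"
    and mor_restr: "mor u v e \<Longrightarrow> u @ z \<in> T \<Longrightarrow>
      \<exists>z'. length z' = length z \<and> mor (u @ z) (v @ z') e"
begin

lemma root_in: "[] \<in> T"
  using rooted by (simp add: rooted_tree_def)

lemma mor_mem: "mor u v e \<Longrightarrow> p \<in> cyl T u \<Longrightarrow> e p \<in> cyl T v"
  using mor_bij bij_betwE by blast

lemma mor_image: "mor u v e \<Longrightarrow> e ` cyl T u = cyl T v"
  using mor_bij bij_betw_imp_surj_on by blast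

lemma mor_inverse:
  assumes "mor u v e"
  obtains e' where "mor v u e'" "\<And>p. p \<in> cyl T u \<Longrightarrow> e' (e p) = p"
    "\<And>q. q \<in> cyl T v \<Longrightarrow> e (e' q) = q"
proof (rule that)
  show "mor v u (inv_into (cyl T u) e)"
    using assms by (rule mor_inv)
  show "inv_into (cyl T u) e (e p) = p" if "p \<in> cyl T u" for p
    using mor_bij[OF assms] that by (meson bij_betw_inv_into_left)
  show "e (inv_into (cyl T u) e q) = q" if "q \<in> cyl T v" for q
    using mor_bij[OF assms] that by (rule bij_betw_inv_into_right)
qed

text \<open>The identity is not postulated: it is a morphism to a representative followed by its
  inverse.\<close>

lemma mor_id:
  assumes "u \<in> T"
  shows "mor u u (\<lambda>p. p)"
proof -
  obtain r e where "mor u r e" using fin_reps assms by blast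
  then obtain e' where e': "mor r u e'" "\<And>p. p \<in> cyl T u \<Longrightarrow> e' (e p) = p"
    using mor_inverse by metis
  have "mor u u (\<lambda>p. e' (e p))" using \<open>mor u r e\<close> e'(1) by (rule mor_comp)
  then show ?thesis by (rule mor_cong) (simp add: e')
qed
end

section \<open>Equivalent restrictions of a map between boundaries\<close>

locale tree_pair = S: tree_structure T mor + S': tree_structure T' mor'
  for T :: "'a list set" and mor and T' :: "'b list set" and mor' +
  fixes f :: "(nat \<Rightarrow> 'a) \<Rightarrow> (nat \<Rightarrow> 'b)"
  assumes f_bdry: "f ` bdry T \<subseteq> bdry T'"
begin

text \<open>All witnesses stay visible, since for compositions the target morphism \<open>d\<close>
  of one map has to be compared with the source morphism of the next.\<close>

definition via :: "'a list \<Rightarrow> 'a list \<Rightarrow> ((nat \<Rightarrow> 'a) \<Rightarrow> (nat \<Rightarrow> 'a)) \<Rightarrow>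
    'b list \<Rightarrow> 'b list \<Rightarrow> ((nat \<Rightarrow> 'b) \<Rightarrow> (nat \<Rightarrow> 'b)) \<Rightarrow> bool" where
  "via v w e x y d \<longleftrightarrow> mor v w e \<and> mor' x y d \<and>
     f ` cyl T v \<subseteq> cyl T' x \<and> f ` cyl T w \<subseteq> cyl T' y \<and> (\<forall>p\<in>cyl T v. f (e p) = d (f p))"

definition vrel :: "'a list \<Rightarrow> 'a list \<Rightarrow> bool" where
  "vrel v w \<longleftrightarrow> (\<exists>e x y d. via v w e x y d)"

definition finitary :: bool where
  "finitary \<longleftrightarrow> (\<exists>S. finite S \<and> S \<subseteq> T \<and> (\<forall>v\<in>T. \<exists>s\<in>S. vrel v s))"

lemma vrel_in: "vrel v w \<Longrightarrow> v \<in> T \<and> w \<in> T"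
  unfolding vrel_def via_def using S.mor_in by blast

text \<open>No minimality is asked of the target vertices, so the root of the target tree always
  serves.\<close>

lemma vrel_refl: "v \<in> T \<Longrightarrow> vrel v v"
  unfolding vrel_def via_def
  using S.mor_id S'.mor_id[OF S'.root_in] f_bdry cyl_subset_bdry[of T v]
  by (intro exI[of _ "\<lambda>p. p"] exI[of _ "[]"]) auto

lemma via_sym:
  assumes "via v w e x y d"
  obtains e' d' where "via w v e' y x d'"
    "\<And>p. p \<in> cyl T v \<Longrightarrow> e' (e p) = p" "\<And>q. q \<in> cyl T w \<Longrightarrow> e (e' q) = q"
    "\<And>p. p \<in> cyl T' x \<Longrightarrow> d' (d p) = p" "\<And>q. q \<in> cyl T' y \<Longrightarrow> d (d' q) = q"
proof -
  have v: "mor v w e" "mor' x y d" "f ` cyl T v \<subseteq> cyl T' x" "f ` cyl T w \<subseteq> cyl T' y"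
    "\<And>p. p \<in> cyl T v \<Longrightarrow> f (e p) = d (f p)"
    using assms by (auto simp: via_def)
  obtain e' where e': "mor w v e'" "\<And>p. p \<in> cyl T v \<Longrightarrow> e' (e p) = p"
      "\<And>q. q \<in> cyl T w \<Longrightarrow> e (e' q) = q"
    using S.mor_inverse[OF v(1)] by metis
  obtain d' where d': "mor' y x d'" "\<And>p. p \<in> cyl T' x \<Longrightarrow> d' (d p) = p"
      "\<And>q. q \<in> cyl T' y \<Longrightarrow> d (d' q) = q"
    using S'.mor_inverse[OF v(2)] by metis
  have "f (e' q) = d' (f q)" if q: "q \<in> cyl T w" for q
  proof -
    have p: "e' q \<in> cyl T v" using S.mor_mem[OF e'(1) q] .
    then have "f q = d (f (e' q))" using v(5)[of "e' q"] e'(3)[OF q] by simp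
    then show ?thesis using d'(2) p v(3) by auto
  qed
  then have "via w v e' y x d'" using v e' d' by (auto simp: via_def)
  then show ?thesis using that e' d' by blast
qed

lemma via_trans:
  assumes "via v w e x y d" "via w u e2 y z d2"
  shows "via v u (\<lambda>p. e2 (e p)) x z (\<lambda>p. d2 (d p))"
proof -
  have "f (e2 (e p)) = d2 (d (f p))" if "p \<in> cyl T v" for p
    using assms S.mor_mem[of v w e p] that unfolding via_def by simp
  moreover have "mor v u (\<lambda>p. e2 (e p))" "mor' x z (\<lambda>p. d2 (d p))"
    using assms S.mor_comp[of v w e u e2] S'.mor_comp[of x y d z d2] unfolding via_def by simp_all
  ultimately show ?thesis
    using assms unfolding via_def by simp
qed

text \<open>Every point of the cylinder of \<open>w\<close> is some \<open>e p\<close>, and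
  \<open>f (e p) = d (f p)\<close>. Hence a deeper target vertex that is admissible for
  \<open>v\<close> is carried by \<open>d\<close> to one that is admissible for
  \<open>w\<close>.\<close>

lemma via_refine:
  assumes via: "via v w e x y d" and sub: "f ` cyl T v \<subseteq> cyl T' (x @ z)"
  obtains z' where "via v w e (x @ z) (y @ z') d"
proof -
  have v: "mor v w e" "mor' x y d" "f ` cyl T v \<subseteq> cyl T' x" "f ` cyl T w \<subseteq> cyl T' y"
    "\<And>p. p \<in> cyl T v \<Longrightarrow> f (e p) = d (f p)"
    using via by (auto simp: via_def)
  obtain p where "p \<in> cyl T v"
    using cyl_nonempty[OF S.rooted S.branch] S.mor_in[OF v(1)] by metis
  then have "f p \<in> cyl T' (x @ z)" using sub by blast
  then obtain z' where z': "mor' (x @ z) (y @ z') d"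
    using S'.mor_restr[OF v(2) cyl_in_tree] by metis
  have "f q \<in> cyl T' (y @ z')" if "q \<in> cyl T w" for q
  proof -
    have "q \<in> e ` cyl T v" using S.mor_image[OF v(1)] that by simp
    then obtain p where p: "p \<in> cyl T v" "q = e p" by (rule imageE)
    then have "f p \<in> cyl T' (x @ z)" using sub by auto
    then show ?thesis using v(5)[OF p(1)] S'.mor_mem[OF z', of "f p"] p(2) by simp
  qed
  then have "f ` cyl T w \<subseteq> cyl T' (y @ z')" by (rule image_subsetI)
  then show ?thesis using that[of z'] v sub z' unfolding via_def by simp
qed

lemma vrel_sym: "vrel v w \<Longrightarrow> vrel w v"
  unfolding vrel_def using via_sym by metis

text \<open>The two given relations may use different target vertices \<open>y\<close> and
  \<open>y2\<close> for \<open>w\<close>. Both cylinders contain the image of a point of the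
  cylinder of \<open>w\<close>, so one vertex extends the other, and the shallower one is refined to
  the deeper. Refinement acts on the first vertex of a pair, which is why one case reverses the
  relation and reverses it back.\<close>

lemma vrel_trans:
  assumes "vrel v w" "vrel w u"
  shows "vrel v u"
proof -
  obtain e x y d where 1: "via v w e x y d" using assms vrel_def by blast
  obtain e2 y2 z2 d2 where 2: "via w u e2 y2 z2 d2" using assms vrel_def by blast
  obtain p where p: "p \<in> cyl T w"
    using cyl_nonempty[OF S.rooted S.branch] vrel_in[OF assms(1)] by metis
  then have "f p \<in> cyl T' y" "f p \<in> cyl T' y2" using 1 2 by (auto simp: via_def)
  then consider z where "y2 = y @ z" | z where "y = y2 @ z"
    using cyl_comparable by blast
  then show ?thesis
  proof cases
    case 1
    obtain e' d' where "via w v e' y x d'" using via_sym[OF \<open>via v w e x y d\<close>] by metis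
    moreover have "f ` cyl T w \<subseteq> cyl T' (y @ z)" using 2 1 by (simp add: via_def)
    ultimately obtain z' where "via w v e' (y @ z) (x @ z') d'" using via_refine by metis
    then obtain e'' d'' where "via v w e'' (x @ z') y2 d''" using via_sym 1 by metis
    from via_trans[OF this 2] show ?thesis unfolding vrel_def by blast
  next
    case 2
    have "f ` cyl T w \<subseteq> cyl T' (y2 @ z)" using 1 2 by (simp add: via_def)
    then obtain z' where "via w u e2 y (z2 @ z') d2"
      using via_refine[OF \<open>via w u e2 y2 z2 d2\<close>] 2 by metis
    from via_trans[OF 1 this] show ?thesis unfolding vrel_def by blast
  qed
qed

text \<open>Finiteness is shown by an invariant with finitely many values that determines the class;
  one vertex per value then represents all classes.\<close>

lemma finitary_if_key:
  assumes "finite (key ` T)" "\<And>v w. v \<in> T \<Longrightarrow> w \<in> T \<Longrightarrow> key v = key w \<Longrightarrow> vrel v w"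
  shows finitary
  unfolding finitary_def
proof (intro exI conjI ballI)
  show "finite (inv_into T key ` key ` T)" using assms(1) by simp
  show "inv_into T key ` key ` T \<subseteq> T" by (auto intro: inv_into_into)
  fix v assume v: "v \<in> T"
  then have "vrel v (inv_into T key (key v))"
    by (intro assms(2)) (auto simp: f_inv_into_f inv_into_into)
  then show "\<exists>s\<in>inv_into T key ` key ` T. vrel v s" using v by blast
qed

lemma finitary_iff_finite_quotient:
  "finitary \<longleftrightarrow> finite (T // {(v, w). v \<in> T \<and> w \<in> T \<and> vrel v w})"
  (is "_ \<longleftrightarrow> finite (T // ?R)")
proof
  assume finitary
  then obtain S where S: "finite S" "S \<subseteq> T" "\<forall>v\<in>T. \<exists>s\<in>S. vrel v s"
    by (auto simp: finitary_def)
  have "T // ?R \<subseteq> (\<lambda>s. ?R `` {s}) ` S"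
  proof
    fix C assume "C \<in> T // ?R"
    then obtain v where v: "v \<in> T" "C = ?R `` {v}" by (auto simp: quotient_def)
    then obtain s where s: "s \<in> S" "vrel v s" using S by blast
    then have "?R `` {v} = ?R `` {s}"
      using v(1) S(2) vrel_trans vrel_sym by blast
    then show "C \<in> (\<lambda>s. ?R `` {s}) ` S" using v s by blast
  qed
  then show "finite (T // ?R)" using S(1) by (meson finite_imageI finite_subset)
next
  assume fin: "finite (T // ?R)"
  show finitary
  proof (rule finitary_if_key)
    have "(\<lambda>v. ?R `` {v}) ` T = T // ?R" by (auto simp: quotient_def)
    then show "finite ((\<lambda>v. ?R `` {v}) ` T)" using fin by simp
    fix v w assume "v \<in> T" "w \<in> T" "?R `` {v} = ?R `` {w}"
    then show "vrel v w" using vrel_refl by blast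
  qed
qed
end

section \<open>Identity, composition and inversion of finitary maps\<close>

lemma finitary_id:
  assumes "tree_structure T mor"
  shows "tree_pair.finitary T mor T mor (\<lambda>p. p)"
proof -
  interpret S: tree_structure T mor by fact
  interpret tree_pair T mor T mor "\<lambda>p. p" by unfold_locales auto
  obtain R where R: "finite R" "R \<subseteq> T" "\<forall>v\<in>T. \<exists>r\<in>R. \<exists>e. mor v r e"
    using S.fin_reps by blast
  have "\<exists>r\<in>R. vrel v r" if v: "v \<in> T" for v
  proof -
    obtain r e where r: "r \<in> R" "mor v r e" using R(3) v by auto
    then have "via v r e v r e" by (simp add: via_def)
    then show ?thesis using r(1) unfolding vrel_def by blast
  qed
  then show ?thesis unfolding finitary_def using R(1,2) by auto
qed

lemma finitary_cong:
  assumes "tree_pair T mor T' mor' f" "tree_pair.finitary T mor T' mor' f"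
    and eq: "\<And>p. p \<in> bdry T \<Longrightarrow> f' p = f p"
  shows "tree_pair.finitary T mor T' mor' f'"
proof -
  interpret A: tree_pair T mor T' mor' f by fact
  interpret B: tree_pair T mor T' mor' f'
    using A.f_bdry eq by unfold_locales auto
  have eq': "f' p = f p" if "p \<in> cyl T v" for p v
    using that eq cyl_subset_bdry by blast
  then have "f' ` cyl T v = f ` cyl T v" for v by (rule image_cong[OF refl])
  then have "B.via v w e x y d" if "A.via v w e x y d" for v w e x y d
    using that A.S.mor_mem[of v w e] eq'[of _ v] eq'[of _ w] unfolding A.via_def B.via_def by simp
  then have "B.vrel v w" if "A.vrel v w" for v w
    using that unfolding A.vrel_def B.vrel_def by metis
  then show ?thesis using assms(2) unfolding A.finitary_def B.finitary_def by metis
qed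

text \<open>The key of a vertex \<open>v\<close> records a representative \<open>s\<close> of its class under \<open>f\<close>, a representative
  \<open>z\<close> of the class under \<open>g\<close> of the vertex \<open>y\<close> used for \<open>v\<close>, and the comparison of the two
  morphisms out of \<open>y\<close>, which ranges over a finite set.\<close>

lemma finitary_comp:
  assumes "tree_pair T mor T' mor' f" "tree_pair T' mor' T'' mor'' g"
    and ff: "tree_pair.finitary T mor T' mor' f" and fg: "tree_pair.finitary T' mor' T'' mor'' g"
    and inj: "inj_on f (bdry T)" "inj_on g (bdry T')"
  shows "tree_pair.finitary T mor T'' mor'' (\<lambda>p. g (f p))"
proof -
  interpret F: tree_pair T mor T' mor' f by fact
  interpret G: tree_pair T' mor' T'' mor'' g by fact
  interpret GF: tree_pair T mor T'' mor'' "\<lambda>p. g (f p)"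
    using F.f_bdry G.f_bdry by unfold_locales auto
  obtain S where S: "finite S" "S \<subseteq> T" "\<forall>v\<in>T. \<exists>s\<in>S. F.vrel v s"
    using ff F.finitary_def by auto
  obtain Z where Z: "finite Z" "Z \<subseteq> T'" "\<forall>v\<in>T'. \<exists>s\<in>Z. G.vrel v s"
    using fg G.finitary_def by auto
  define X where "X s = {x. f ` cyl T s \<subseteq> cyl T' x}" for s
  define Y where "Y z = {b. g ` cyl T' z \<subseteq> cyl T'' b}" for z
  define K where "K x z = (\<lambda>e. restrict e (cyl T' x)) ` {e. mor' x z e}" for x z
  define U where "U = (SIGMA s:S. SIGMA x:X s. SIGMA z:Z. Y z \<times> K x z)"
  \<comment> \<open>On the cylinder of \<open>x\<close> the map \<open>c\<close> is
    \<open>e'\<close> after the inverse of \<open>d\<close>. It measures how the morphism supplied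
    by \<open>f\<close> and the one supplied by \<open>g\<close> differ at the middle vertex
    \<open>y\<close>.\<close>
  define D where "D v k \<longleftrightarrow> (\<exists>s e y x d z e' a b d' c. k = (s, x, z, b, restrict c (cyl T' x)) \<and>
     F.via v s e y x d \<and> G.via y z e' a b d' \<and> (\<forall>p\<in>cyl T' y. c (d p) = e' p))" for v k
  have finU: "finite U"
    unfolding U_def
  proof (intro finite_SigmaI finite_cartesian_product)
    show "finite (X s)" if "s \<in> S" for s
      unfolding X_def using that S F.S.rooted F.S.branch inj by (intro finite_containing_cyl_image) auto
    show "finite (Y z)" if "z \<in> Z" for z
      unfolding Y_def using that Z F.S'.rooted F.S'.branch inj by (intro finite_containing_cyl_image) auto
    show "finite (K x z)" for x z unfolding K_def by (rule F.S'.mor_fin)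
  qed (use S Z in auto)
  have ex: "\<exists>k\<in>U. D v k" if v: "v \<in> T" for v
  proof -
    obtain s e y x d where s: "s \<in> S" "F.via v s e y x d" using S(3) v unfolding F.vrel_def by metis
    then have y: "y \<in> T'" using F.S'.mor_in[of y x d] by (simp add: F.via_def)
    then obtain z e' a b d' where z: "z \<in> Z" "G.via y z e' a b d'" using Z(3) y unfolding G.vrel_def by metis
    have d: "mor' y x d" "mor' y z e'" using s z by (auto simp: F.via_def G.via_def)
    obtain c where c: "mor' x y c" "\<And>p. p \<in> cyl T' y \<Longrightarrow> c (d p) = p"
      using F.S'.mor_inverse[OF d(1)] by metis
    define c' where "c' = (\<lambda>p. e' (c p))"
    have "mor' x z c'" unfolding c'_def using c(1) d(2) by (rule F.S'.mor_comp)
    then have "(s, x, z, b, restrict c' (cyl T' x)) \<in> U"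
      using s z by (auto simp: U_def X_def Y_def K_def F.via_def G.via_def)
    moreover have "\<forall>p\<in>cyl T' y. c' (d p) = e' p" using c by (simp add: c'_def)
    ultimately show ?thesis unfolding D_def using s z by blast
  qed
  then obtain key where key: "\<And>v. v \<in> T \<Longrightarrow> key v \<in> U \<and> D v (key v)" by metis
  show ?thesis
  proof (rule GF.finitary_if_key)
    show "finite (key ` T)" using key finU by (meson finite_subset image_subsetI)
    fix v1 v2 assume v: "v1 \<in> T" "v2 \<in> T" "key v1 = key v2"
    obtain s x z b c where k: "key v1 = (s, x, z, b, c)" by (metis prod_cases5)
    obtain e1 y1 d1 e1' a1 d1' c1 where 1: "c = restrict c1 (cyl T' x)"
        "F.via v1 s e1 y1 x d1" "G.via y1 z e1' a1 b d1'" "\<forall>p\<in>cyl T' y1. c1 (d1 p) = e1' p"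
      using key[OF v(1)] unfolding D_def k by auto
    obtain e2 y2 d2 e2' a2 d2' c2 where 2: "c = restrict c2 (cyl T' x)"
        "F.via v2 s e2 y2 x d2" "G.via y2 z e2' a2 b d2'" "\<forall>p\<in>cyl T' y2. c2 (d2 p) = e2' p"
      using key[OF v(2)] unfolding D_def v(3)[symmetric] k by auto
    obtain e3 d3 where 3: "F.via s v2 e3 x y2 d3"
        "\<And>q. q \<in> cyl T' x \<Longrightarrow> d2 (d3 q) = q"
      using F.via_sym[OF 2(2)] by metis
    obtain e4 d4 where 4: "G.via z y2 e4 b a2 d4" "\<And>p. p \<in> cyl T' y2 \<Longrightarrow> e4 (e2' p) = p"
      using G.via_sym[OF 2(3)] by metis
    have f: "F.via v1 v2 (\<lambda>p. e3 (e1 p)) y1 y2 (\<lambda>p. d3 (d1 p))"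
      using 1(2) 3(1) by (rule F.via_trans)
    have g: "G.via y1 y2 (\<lambda>p. e4 (e1' p)) a1 a2 (\<lambda>p. d4 (d1' p))"
      using 1(3) 4(1) by (rule G.via_trans)
    \<comment> \<open>The heart of the matter: the morphisms from \<open>y1\<close> to
      \<open>y2\<close> through \<open>x\<close> and through \<open>z\<close> agree, because both
      keys contain the same comparison map. Only this allows the witnesses for \<open>f\<close> and
      \<open>g\<close> to be glued.\<close>
    have eq: "d3 (d1 p) = e4 (e1' p)" if p: "p \<in> cyl T' y1" for p
    proof -
      have q: "d1 p \<in> cyl T' x" using p 1(2) F.S'.mor_mem[of y1 x d1] unfolding F.via_def by simp
      then have r: "d3 (d1 p) \<in> cyl T' y2" using 3(1) q F.S'.mor_mem[of x y2 d3] unfolding F.via_def by simp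
      have "e1' p = c1 (d1 p)" using 1(4) p by simp
      also have "\<dots> = c2 (d1 p)" using fun_cong[OF trans[OF 1(1)[symmetric] 2(1)], of "d1 p"] q by simp
      also have "\<dots> = c2 (d2 (d3 (d1 p)))" using 3(2) q by simp
      also have "\<dots> = e2' (d3 (d1 p))" using 2(4) r by simp
      finally show ?thesis using 4(2) r by simp
    qed
    have "GF.via v1 v2 (\<lambda>p. e3 (e1 p)) a1 a2 (\<lambda>p. d4 (d1' p))"
      unfolding GF.via_def
    proof (intro conjI ballI)
      fix p assume p: "p \<in> cyl T v1"
      then have fp: "f p \<in> cyl T' y1" using f by (auto simp: F.via_def)
      have "f (e3 (e1 p)) = d3 (d1 (f p))" using f p by (auto simp: F.via_def)
      then show "g (f (e3 (e1 p))) = d4 (d1' (g (f p)))"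
        using eq[OF fp] g fp by (auto simp: G.via_def)
    qed (use f g in \<open>simp_all add: F.via_def G.via_def image_subset_iff\<close>)
    then show "GF.vrel v1 v2" unfolding GF.vrel_def by metis
  qed
qed

text \<open>For a vertex \<open>x\<close> of the target let \<open>v\<close> be the deepest vertex with
  \<open>cyl T' x \<subseteq> f ` cyl T v\<close>. Transporting \<open>v\<close> to the representative \<open>s\<close> of its class carries \<open>x\<close> to
  a vertex that lies in no \<open>f ` cyl T (s @ [a])\<close>, and by Koenig's lemma only finitely many
  vertices that meet \<open>f ` cyl T s\<close> have this property.\<close>

lemma finitary_inverse:
  assumes "tree_pair T mor T' mor' f" and ff: "tree_pair.finitary T mor T' mor' f"
    and homeo: "cyl_homeo T T' f g"
  shows "tree_pair.finitary T' mor' T mor g"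
proof -
  interpret F: tree_pair T mor T' mor' f by fact
  interpret G: tree_pair T' mor' T mor g
    using homeo by unfold_locales (auto simp: cyl_homeo_def)
  have gf: "g (f p) = p" if "p \<in> cyl T v" for p v
    using homeo that cyl_subset_bdry unfolding cyl_homeo_def by blast
  have fg: "f (g q) = q" if "q \<in> cyl T' v" for q v
    using homeo that cyl_subset_bdry unfolding cyl_homeo_def by blast
  obtain S where S: "finite S" "S \<subseteq> T" "\<forall>v\<in>T. \<exists>s\<in>S. F.vrel v s"
    using ff F.finitary_def by auto
  define Z where "Z s = {x \<in> T'. f ` cyl T s \<inter> cyl T' x \<noteq> {} \<and>
      (\<forall>a. s @ [a] \<in> T \<longrightarrow> \<not> cyl T' x \<subseteq> f ` cyl T (s @ [a]))}" for s
  have finZ: "finite (Z s)" for s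
  proof (rule ccontr)
    assume inf: "infinite (Z s)"
    have pre: "u \<in> Z s" if "u @ [a] \<in> Z s" for u a
      using that rooted_prefix[OF F.S'.rooted, of u "[a]"] cyl_append_subset[of T' u "[a]"]
      unfolding Z_def by blast
    have "Z s \<subseteq> T'" by (auto simp: Z_def)
    from Koenig[OF F.S'.rooted F.S'.locfin this inf] pre
    obtain p where p: "p \<in> bdry T'" "\<And>n. pref p n \<in> Z s" by metis
    have gp: "g p \<in> bdry T" using homeo p by (auto simp: cyl_homeo_def)
    \<comment> \<open>One letter beyond \<open>s\<close>: continuity of \<open>g\<close> at
      \<open>p\<close> sends a whole cylinder around \<open>p\<close> into a single cylinder of
      depth \<open>Suc (length s)\<close>. As \<open>pref p m\<close> is in \<open>Z s\<close>, that
      cylinder meets the one of \<open>s\<close>, so it belongs to a child of \<open>s\<close>,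
      which the definition of \<open>Z s\<close> excludes.\<close>
    obtain m where m: "g ` cyl T' (pref p m) \<subseteq> cyl T (pref (g p) (Suc (length s)))"
      using homeo p(1) unfolding cyl_homeo_def cyl_cont_def by metis
    obtain q where q: "q \<in> cyl T s" "f q \<in> cyl T' (pref p m)"
      using p(2)[of m] unfolding Z_def by auto
    then have "q \<in> cyl T (pref (g p) (Suc (length s)))" using m gf by fastforce
    then have sp: "s = pref (g p) (length s)"
      using q(1) by (auto simp: cyl_def pref_Suc)
    then have sn: "pref (g p) (Suc (length s)) = s @ [g p (length s)]"
      by (simp add: pref_Suc)
    then have "s @ [g p (length s)] \<in> T" using gp unfolding bdry_def by (metis mem_Collect_eq)
    moreover have "cyl T' (pref p m) \<subseteq> f ` cyl T (s @ [g p (length s)])"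
      using m fg unfolding sn by (metis image_subset_iff image_eqI subsetI)
    ultimately show False using p(2)[of m] by (auto simp: Z_def)
  qed
  have main: "\<exists>z\<in>(\<Union>s\<in>S. Z s). G.vrel x z" if x: "x \<in> T'" for x
  proof -
    define V where "V = {v. g ` cyl T' x \<subseteq> cyl T v}"
    have "finite V" unfolding V_def
      using x F.S'.rooted F.S'.branch cyl_homeo_inj_on[OF cyl_homeo_sym[OF homeo]]
      by (intro finite_containing_cyl_image) auto
    moreover have "[] \<in> V"
      using G.f_bdry cyl_subset_bdry[of T' x] by (auto simp: V_def)
    ultimately have "Max (length ` V) \<in> length ` V" "\<And>u. u \<in> V \<Longrightarrow> length u \<le> Max (length ` V)"
      by (metis Max_in empty_iff finite_imageI image_is_empty, simp)
    then obtain v where v: "v \<in> V" "\<And>u. u \<in> V \<Longrightarrow> length u \<le> length v"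
      by (metis imageE)
    have gx: "g ` cyl T' x \<subseteq> cyl T v" using v(1) by (simp add: V_def)
    obtain q0 where q0: "q0 \<in> cyl T' x"
      using cyl_nonempty[OF F.S'.rooted F.S'.branch x] by metis
    then have "v \<in> T" using gx cyl_in_tree by blast
    then obtain s e a b d where s: "s \<in> S" "F.via v s e a b d" using S(3) unfolding F.vrel_def by metis
    have vi: "mor v s e" "mor' a b d" "f ` cyl T v \<subseteq> cyl T' a" "f ` cyl T s \<subseteq> cyl T' b"
      "\<And>p. p \<in> cyl T v \<Longrightarrow> f (e p) = d (f p)"
      using s(2) by (auto simp: F.via_def)
    have fgx: "cyl T' x \<subseteq> f ` cyl T v"
      using gx fg by (metis image_subset_iff image_eqI subsetI)
    \<comment> \<open>This places \<open>x\<close> below \<open>a\<close>, so that \<open>d\<close>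
      restricts to a morphism out of \<open>x\<close>.\<close>
    then have "cyl T' x \<subseteq> cyl T' a" using vi(3) by blast
    then obtain t where t: "x = a @ t"
      using cyl_subset_imp_append[OF F.S'.rooted F.S'.branch x] by metis
    obtain t' where t': "mor' x (b @ t') d" using F.S'.mor_restr[OF vi(2), of t] x unfolding t by auto
    have im: "d ` cyl T' x = cyl T' (b @ t')" using F.S'.mor_image[OF t'] .
    have ge: "g (d q) = e (g q)" if "q \<in> cyl T' x" for q
    proof -
      have "g q \<in> cyl T v" using gx that by auto
      then have "d q = f (e (g q))" "e (g q) \<in> cyl T s"
        using vi(5)[of "g q"] fg[OF that] F.S.mor_mem[OF vi(1)] by auto
      then show ?thesis using gf by auto
    qed
    have gz: "g ` cyl T' (b @ t') \<subseteq> cyl T s"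
      unfolding im[symmetric] using ge gx F.S.mor_mem[OF vi(1)] by auto
    have "b @ t' \<in> Z s"
      unfolding Z_def
    proof (intro CollectI conjI allI impI)
      show "b @ t' \<in> T'" using F.S'.mor_in[OF t'] by simp
      have "d q0 \<in> cyl T' (b @ t')" using F.S'.mor_mem[OF t' q0] .
      moreover from this have "g (d q0) \<in> cyl T s" "f (g (d q0)) = d q0" using gz fg by auto
      ultimately show "f ` cyl T s \<inter> cyl T' (b @ t') \<noteq> {}" by (metis disjoint_iff image_eqI)
      fix c assume c: "s @ [c] \<in> T"
      show "\<not> cyl T' (b @ t') \<subseteq> f ` cyl T (s @ [c])"
      proof
        assume sub: "cyl T' (b @ t') \<subseteq> f ` cyl T (s @ [c])"
        obtain e' where e': "mor s v e'" "\<And>p. p \<in> cyl T v \<Longrightarrow> e' (e p) = p"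
          using F.S.mor_inverse[OF vi(1)] by metis
        obtain c' where c': "length c' = 1" "mor (s @ [c]) (v @ c') e'"
          using F.S.mor_restr[OF e'(1) c] by auto
        have "g q \<in> cyl T (v @ c')" if q: "q \<in> cyl T' x" for q
        proof -
          have "d q \<in> f ` cyl T (s @ [c])" using F.S'.mor_mem[OF t' q] sub by auto
          then have "g (d q) \<in> cyl T (s @ [c])" using gf by auto
          then have "e' (e (g q)) \<in> cyl T (v @ c')"
            using ge[OF q] F.S.mor_mem[OF c'(2)] by metis
          then show ?thesis using e'(2) gx q by auto
        qed
        then have "v @ c' \<in> V" by (auto simp: V_def)
        then show False using v(2)[of "v @ c'"] c'(1) by simp
      qed
    qed
    moreover have "G.via x (b @ t') d v s e"
      unfolding G.via_def using t' vi(1) gx gz ge by auto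
    ultimately show ?thesis using s(1) unfolding G.vrel_def by blast
  qed
  show ?thesis
    unfolding G.finitary_def
  proof (intro exI conjI)
    show "finite (\<Union>s\<in>S. Z s)" using S finZ by blast
    show "(\<Union>s\<in>S. Z s) \<subseteq> T'" by (auto simp: Z_def)
  qed (use main in blast)
qed

section \<open>The binary tree\<close>

definition prep :: "'a list \<Rightarrow> (nat \<Rightarrow> 'a) \<Rightarrow> (nat \<Rightarrow> 'a)" where
  "prep w z = (\<lambda>i. if i < length w then w ! i else z (i - length w))"

definition shift :: "nat \<Rightarrow> (nat \<Rightarrow> 'a) \<Rightarrow> (nat \<Rightarrow> 'a)" where
  "shift n p = (\<lambda>i. p (n + i))"

lemma prep_Nil [simp]: "prep [] z = z"
  by (simp add: prep_def)

lemma prep_append: "prep (u @ w) z = prep u (prep w z)"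
  by (auto simp: prep_def fun_eq_iff nth_append)

lemma shift_prep [simp]: "shift (length w) (prep w z) = z"
  by (auto simp: prep_def shift_def)

lemma prep_pref_shift [simp]: "prep (pref p n) (shift n p) = p"
  by (auto simp: prep_def shift_def)

lemma prep_add [simp]: "prep w z (length w + i) = z i"
  by (simp add: prep_def)

lemma prep_nth [simp]: "i < length w \<Longrightarrow> prep w z i = w ! i"
  by (simp add: prep_def)

lemma prep_inject [simp]: "prep w y = prep w z \<longleftrightarrow> y = z"
  by (metis shift_prep)

lemma pref_prep [simp]: "pref (prep w z) (length w) = w"
  by (simp add: pref_eq_list_iff)

lemma bdry_UNIV [simp]: "bdry UNIV = UNIV"
  by (simp add: bdry_def)

lemma cyl_UNIV: "cyl UNIV w = range (prep w)"
proof
  show "cyl UNIV w \<subseteq> range (prep w)"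
    unfolding cyl_UNIV_iff[abs_def] subset_iff by (metis cyl_UNIV_iff prep_pref_shift rangeI)
qed (auto simp: cyl_UNIV_iff)

lemma prep_in_cyl [simp]: "prep w z \<in> cyl UNIV w"
  by (simp add: cyl_UNIV)

lemma rooted_tree_UNIV: "rooted_tree UNIV"
  by (simp add: rooted_tree_def)

text \<open>For each pair of vertices there is one morphism, up to values off the cylinder:
  replacement of the prefix. All vertices look alike, so the root represents them all.\<close>

definition bmor :: "bool list \<Rightarrow> bool list \<Rightarrow> ((nat \<Rightarrow> bool) \<Rightarrow> (nat \<Rightarrow> bool)) \<Rightarrow> bool" where
  "bmor u v e \<longleftrightarrow> (\<forall>z. e (prep u z) = prep v z)"

lemma bmor_shift: "bmor u v (\<lambda>p. prep v (shift (length u) p))"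
  by (simp add: bmor_def)

interpretation B: tree_structure UNIV bmor
proof
  show "rooted_tree (UNIV :: bool list set)" by (rule rooted_tree_UNIV)
  show "locally_finite (UNIV :: bool list set)" by (simp add: locally_finite_def)
  show "branching (UNIV :: bool list set)" by (auto simp: branching_def)
  show "\<exists>R. finite R \<and> R \<subseteq> UNIV \<and> (\<forall>v\<in>UNIV. \<exists>r\<in>R. \<exists>e. bmor v r e)"
    by (intro exI[of _ "{[]}"]) (auto intro: bmor_shift)
  fix u v :: "bool list" and e :: "(nat \<Rightarrow> bool) \<Rightarrow> (nat \<Rightarrow> bool)"
  show "u \<in> UNIV \<and> v \<in> UNIV" by simp
  show "finite ((\<lambda>e. restrict e (cyl UNIV u)) ` {e. bmor u v e})"
  proof (rule finite_subset)
    show "(\<lambda>e. restrict e (cyl UNIV u)) ` {e. bmor u v e} \<subseteq>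
        {restrict (\<lambda>p. prep v (shift (length u) p)) (cyl UNIV u)}"
      by (auto simp: bmor_def cyl_UNIV intro!: restrict_ext)
  qed simp
  assume e: "bmor u v e"
  then have eu: "e (prep u z) = prep v z" for z by (simp add: bmor_def)
  show bij: "bij_betw e (cyl UNIV u) (cyl UNIV v)"
    unfolding bij_betw_def cyl_UNIV by (auto simp: eu inj_on_def image_image)
  show "bmor u v e'" if "\<And>p. p \<in> cyl UNIV u \<Longrightarrow> e' p = e p" for e'
    using that eu by (simp add: bmor_def)
  show "bmor u w (\<lambda>p. d (e p))" if "bmor v w d" for w d
    using that e by (simp add: bmor_def)
  show "bmor v u (inv_into (cyl UNIV u) e)"
    unfolding bmor_def using bij eu
    by (metis bij_betw_imp_inj_on inv_into_f_f prep_in_cyl)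
  show "\<exists>z'. length z' = length z \<and> bmor (u @ z) (v @ z') e" for z
    using eu by (intro exI[of _ z]) (simp add: bmor_def prep_append)
qed

section \<open>Transducers\<close>

lemma trun_add: "trun \<delta> q x (m + n) = trun \<delta> (trun \<delta> q x m) (shift m x) n"
  by (induction n) (simp_all add: shift_def)

lemma tout_0 [simp]: "tout \<delta> out q x 0 = []"
  by (simp add: tout_def)

lemma tout_Suc: "tout \<delta> out q x (Suc n) = tout \<delta> out q x n @ out (trun \<delta> q x n) (x n)"
  by (simp add: tout_def)

lemma tout_add:
  "tout \<delta> out q x (m + n) = tout \<delta> out q x m @ tout \<delta> out (trun \<delta> q x m) (shift m x) n"
  by (induction n) (simp_all add: tout_Suc trun_add shift_def)

lemma trun_cong: "(\<And>i. i < n \<Longrightarrow> x i = y i) \<Longrightarrow> trun \<delta> q x n = trun \<delta> q y n"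
  by (induction n) simp_all

lemma tout_cong: "(\<And>i. i < n \<Longrightarrow> x i = y i) \<Longrightarrow> tout \<delta> out q x n = tout \<delta> out q y n"
  by (induction n) (simp_all add: tout_Suc cong: trun_cong)

lemma length_tout_mono: "m \<le> n \<Longrightarrow> length (tout \<delta> out q x m) \<le> length (tout \<delta> out q x n)"
  using tout_add[of \<delta> out q x m "n - m"] by simp

text \<open>The value at \<open>prep u z\<close> is the output along \<open>u\<close> followed by
  what the state reached after \<open>u\<close> emits on \<open>z\<close>. Words that reach the same
  state therefore have equivalent restrictions, with the two outputs as target vertices.\<close>

lemma transducer_imp_finitary:
  assumes tr: "transducer Q q0 \<delta>" and nd: "nondegenerate \<delta> out q0" and co: "computes \<delta> out q0 f"
  shows "tree_pair.finitary UNIV bmor UNIV bmor f"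
proof -
  interpret tree_pair UNIV bmor UNIV bmor f by unfold_locales auto
  \<comment> \<open>The padding by \<open>False\<close> is arbitrary: state and output after
    \<open>length u\<close> letters depend on \<open>u\<close> alone.\<close>
  define st where "st u = trun \<delta> q0 (prep u (\<lambda>_. False)) (length u)" for u
  define ou where "ou u = tout \<delta> out q0 (prep u (\<lambda>_. False)) (length u)" for u
  have st: "trun \<delta> q0 (prep u z) (length u) = st u" for u z
    unfolding st_def by (rule trun_cong) simp
  have ou: "tout \<delta> out q0 (prep u z) (length u) = ou u" for u z
    unfolding ou_def by (rule tout_cong) simp
  have out_add: "tout \<delta> out q0 (prep u z) (length u + n) = ou u @ tout \<delta> out (st u) z n" for u z n
    by (simp add: tout_add st ou)
  have out_f: "f (prep u z) i = (ou u @ tout \<delta> out (st u) z n) ! i"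
    if "i < length (ou u @ tout \<delta> out (st u) z n)" for u z n i
    using co that unfolding computes_def out_add[symmetric] by blast
  \<comment> \<open>Nondegeneracy is assumed only from \<open>q0\<close>; the output from a reached
    state is a tail of an infinite output, hence infinite.\<close>
  have long: "\<exists>n. j < length (tout \<delta> out (st u) z n)" for u z j
  proof -
    obtain N where N: "Suc (length (ou u) + j) \<le> length (tout \<delta> out q0 (prep u z) N)"
      using nd unfolding nondegenerate_def by blast
    also have "\<dots> \<le> length (tout \<delta> out q0 (prep u z) (length u + N))"
      by (rule length_tout_mono) simp
    finally have "j < length (tout \<delta> out (st u) z N)" by (simp add: out_add)
    then show ?thesis by blast
  qed
  have f_ou: "f (prep u z) \<in> cyl UNIV (ou u)" for u z
    unfolding mem_cyl_iff using out_f[of _ u z 0] by simp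
  have f_tail: "f (prep u z) (length (ou u) + j) = f (prep w z) (length (ou w) + j)"
    if eq: "st u = st w" for u w z j
  proof -
    obtain n where n: "j < length (tout \<delta> out (st u) z n)" using long by blast
    then have "f (prep u z) (length (ou u) + j) = tout \<delta> out (st u) z n ! j"
      using out_f[of "length (ou u) + j" u z n] by simp
    also have "\<dots> = f (prep w z) (length (ou w) + j)"
      using out_f[of "length (ou w) + j" w z n] n eq by simp
    finally show ?thesis .
  qed
  show ?thesis
  proof (rule finitary_if_key)
    have "st u \<in> Q" for u
    proof -
      have "trun \<delta> q0 x n \<in> Q" for x n
        using tr by (induction n) (auto simp: transducer_def)
      then show ?thesis by (simp add: st_def)
    qed
    then show "finite (range st)"
      using tr by (meson finite_subset image_subsetI transducer_def)
    fix u w assume eq: "st u = st w"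
    let ?e = "\<lambda>p. prep w (shift (length u) p)"
    let ?d = "\<lambda>p. prep (ou w) (shift (length (ou u)) p)"
    have "f (prep w z) = ?d (f (prep u z))" for z
    proof
      fix i
      show "f (prep w z) i = ?d (f (prep u z)) i"
      proof (cases "i < length (ou w)")
        case True
        then show ?thesis using f_ou[of w z] by (simp add: mem_cyl_iff)
      next
        case False
        then show ?thesis
          using f_tail[OF eq, of z "i - length (ou w)"] by (simp add: prep_def shift_def)
      qed
    qed
    then have "via u w ?e (ou u) (ou w) ?d"
      unfolding via_def using f_ou by (auto simp: bmor_shift cyl_UNIV[of u] cyl_UNIV[of w])
    then show "vrel u w" unfolding vrel_def by blast
  qed
qed

text \<open>For the converse, the states are the original map together with its local actions, that is
  the maps \<open>z \<mapsto> f (prep u z)\<close> with the longest common prefix of all values removed.\<close>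

definition split_level :: "((nat \<Rightarrow> bool) \<Rightarrow> (nat \<Rightarrow> bool)) \<Rightarrow> nat" where
  "split_level F = (LEAST n. \<exists>x y. F x n \<noteq> F y n)"

definition strip :: "((nat \<Rightarrow> bool) \<Rightarrow> (nat \<Rightarrow> bool)) \<Rightarrow> ((nat \<Rightarrow> bool) \<Rightarrow> (nat \<Rightarrow> bool))" where
  "strip F = (\<lambda>z. shift (split_level F) (F z))"

lemma split_level_agree: "n < split_level F \<Longrightarrow> F x n = F y n"
  unfolding split_level_def using not_less_Least by blast

lemma strip_decomp: "F z = prep (pref (F c) (split_level F)) (strip F z)"
proof -
  have "pref (F c) (split_level F) = pref (F z) (split_level F)"
    unfolding pref_eq_iff using split_level_agree by blast
  then show ?thesis by (simp add: strip_def)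
qed

text \<open>For a constant map the \<open>LEAST\<close> would range over an empty set; two distinct
  values ensure that it is attained.\<close>

lemma split_level_ge:
  assumes "F a \<noteq> F b" "\<And>x y n. n < m \<Longrightarrow> F x n = F y n"
  shows "m \<le> split_level F"
proof -
  obtain n where "F a n \<noteq> F b n" using assms(1) by auto
  then have "\<exists>n. \<exists>x y. F x n \<noteq> F y n" by blast
  then have "\<exists>x y. F x (split_level F) \<noteq> F y (split_level F)"
    unfolding split_level_def by (rule LeastI_ex)
  then show ?thesis using assms(2) not_le_imp_less by blast
qed

lemma split_level_prep:
  assumes FG: "\<And>z. F z = prep w (G z)" and ne: "G a \<noteq> G b"
  shows "split_level F = length w + split_level G"
proof (rule antisym)
  obtain n where "G a n \<noteq> G b n" using ne by auto
  then have "\<exists>n. \<exists>x y. G x n \<noteq> G y n" by blast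
  then have "\<exists>x y. G x (split_level G) \<noteq> G y (split_level G)"
    unfolding split_level_def by (rule LeastI_ex)
  then have "\<exists>x y. F x (length w + split_level G) \<noteq> F y (length w + split_level G)"
    by (simp add: FG)
  then show "split_level F \<le> length w + split_level G"
    unfolding split_level_def[of F] by (rule Least_le)
  show "length w + split_level G \<le> split_level F"
  proof (rule split_level_ge)
    show "F a \<noteq> F b" using ne by (simp add: FG)
    show "F x n = F y n" if "n < length w + split_level G" for x y n
      using that split_level_agree[of "n - length w" G x y] by (auto simp: FG prep_def)
  qed
qed

text \<open>Equivalent vertices have local maps that differ only in a fixed prefix in front of a
  common \<open>G\<close>; stripping erases exactly this difference.\<close>

lemma strip_prep:
  assumes FG: "\<And>z. F z = prep w (G z)" and ne: "G a \<noteq> G b"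
  shows "strip F = strip G"
  using split_level_prep[of F w G a b] assms
  by (simp add: strip_def shift_def add.assoc)

text \<open>After a nonempty input \<open>u\<close> the machine has emitted exactly the longest
  common prefix of the values of \<open>f\<close> on the cylinder of \<open>u\<close>; by continuity
  its length is unbounded along every input, which is nondegeneracy. Output appears only along with
  an input letter, so a common prefix of all values of \<open>f\<close> cannot be sent in advance:
  the initial state is \<open>f\<close> itself, not \<open>strip f\<close>.\<close>

lemma finitary_imp_transducer:
  assumes inj: "inj f" and cont: "cyl_cont UNIV UNIV f"
    and fin: "tree_pair.finitary UNIV bmor UNIV bmor f"
  shows "\<exists>Q q0 \<delta> out. transducer Q q0 \<delta> \<and> nondegenerate \<delta> out q0 \<and> computes \<delta> out q0 f"
proof -
  interpret tree_pair UNIV bmor UNIV bmor f by unfold_locales auto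
  define fu where "fu u = (\<lambda>z. f (prep u z))" for u
  have fu_ne: "fu u (\<lambda>_. False) \<noteq> fu u (\<lambda>_. True)" for u
  proof -
    have "(\<lambda>_::nat. False) \<noteq> (\<lambda>_. True)" by (simp add: fun_eq_iff)
    then show ?thesis using inj by (simp add: fu_def inj_eq)
  qed
  have loc_eq: "strip (fu u) = strip (fu w)" if uw: "vrel u w" for u w
  proof -
    obtain e x y d where via: "via u w e x y d" using uw unfolding vrel_def by blast
    then have d: "d (prep x z) = prep y z" and fx: "f (prep u z) \<in> cyl UNIV x" for z
      by (auto simp: via_def bmor_def)
    have fd: "f (prep w z) = d (f (prep u z))" for z
      using via prep_in_cyl[of u z] unfolding via_def bmor_def by metis
    define G where "G = (\<lambda>z. shift (length x) (fu u z))"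
    have fG: "fu u z = prep x (G z)" for z
      using fx[of z] unfolding cyl_UNIV_iff G_def fu_def by (metis prep_pref_shift)
    then have fG': "fu w z = prep y (G z)" for z
      using fd[of z] d by (simp add: fu_def)
    have "G (\<lambda>_. False) \<noteq> G (\<lambda>_. True)" using fu_ne[of u] fG by simp
    then show ?thesis using strip_prep[of "fu u", OF fG] strip_prep[of "fu w", OF fG'] by simp
  qed
  define L where "L = insert f (range (\<lambda>u. strip (fu u)))"
  obtain S where S: "finite S" "\<forall>v\<in>UNIV. \<exists>s\<in>S. vrel v s"
    using fin unfolding finitary_def by blast
  have "range (\<lambda>u. strip (fu u)) \<subseteq> (\<lambda>u. strip (fu u)) ` S"
  proof (rule image_subsetI)
    fix u
    obtain s where s: "s \<in> S" "vrel u s" using S(2) by auto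
    then show "strip (fu u) \<in> (\<lambda>u. strip (fu u)) ` S" using loc_eq[of u s] by simp
  qed
  then have "finite (range (\<lambda>u. strip (fu u)))" using S(1) finite_surj by blast
  then have "finite L" by (simp add: L_def)
  from finite_imp_inj_to_nat_seg[OF this]
  obtain enc :: "_ \<Rightarrow> nat" where enc: "inj_on enc L" by (elim exE conjE)
  define dec where "dec = inv_into L enc"
  have dec [simp]: "dec (enc g) = g" if "g \<in> L" for g
    unfolding dec_def using enc that by simp
  define act where "act g b = (\<lambda>z. g (prep [b] z))" for g :: "(nat \<Rightarrow> bool) \<Rightarrow> (nat \<Rightarrow> bool)" and b
  define \<delta> where "\<delta> q b = enc (strip (act (dec q) b))" for q b
  define out where "out q b = (let F = act (dec q) b in pref (F (\<lambda>_. False)) (split_level F))" for q b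
  have strip_act: "strip (act g b) = strip (fu (u @ [b])) \<and>
      split_level (fu (u @ [b])) = length w + split_level (act g b)"
    if g: "\<And>z. fu u z = prep w (g z)" for g u w b
  proof -
    have F: "fu (u @ [b]) z = prep w (act g b z)" for z
      using g by (simp add: fu_def act_def prep_append)
    then have "act g b (\<lambda>_. False) \<noteq> act g b (\<lambda>_. True)" using fu_ne[of "u @ [b]"] by simp
    then show ?thesis
      using strip_prep[of "fu (u @ [b])", OF F] split_level_prep[of "fu (u @ [b])", OF F] by simp
  qed
  have strip_L: "strip (fu u) \<in> L" for u by (simp add: L_def)
  \<comment> \<open>The clause on the length is guarded by \<open>0 < n\<close>: nothing has been
    emitted at the start, while \<open>split_level f\<close> may be positive.\<close>
  have run: "\<exists>g\<in>L. trun \<delta> (enc f) x n = enc g \<and> (\<forall>z. fu (pref x n) z = prep (tout \<delta> out (enc f) x n) (g z)) \<and>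
      (0 < n \<longrightarrow> length (tout \<delta> out (enc f) x n) = split_level (fu (pref x n)))" for x n
  proof (induction n)
    case 0
    show ?case by (intro bexI[of _ f]) (auto simp: fu_def L_def)
  next
    case (Suc n)
    then obtain g where g: "g \<in> L" "trun \<delta> (enc f) x n = enc g"
        "\<And>z. fu (pref x n) z = prep (tout \<delta> out (enc f) x n) (g z)" by blast
    have s: "strip (act g (x n)) = strip (fu (pref x (Suc n)))"
        "split_level (fu (pref x (Suc n))) = length (tout \<delta> out (enc f) x n) + split_level (act g (x n))"
      using strip_act[OF g(3), of "x n"] by (simp_all add: pref_Suc)
    have out: "out (enc g) (x n) = pref (act g (x n) (\<lambda>_. False)) (split_level (act g (x n)))"
      using g(1) by (simp add: out_def Let_def)
    show ?case
    proof (intro bexI[of _ "strip (act g (x n))"] conjI allI impI)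
      show "strip (act g (x n)) \<in> L" using s strip_L by simp
      show "trun \<delta> (enc f) x (Suc n) = enc (strip (act g (x n)))"
        using g by (simp add: \<delta>_def)
      fix z
      have "fu (pref x (Suc n)) z = prep (tout \<delta> out (enc f) x n) (act g (x n) z)"
        using g(3)[of "prep [x n] z"] by (simp add: fu_def act_def pref_Suc prep_append)
      also have "\<dots> = prep (tout \<delta> out (enc f) x n) (prep (out (enc g) (x n)) (strip (act g (x n)) z))"
        unfolding out using strip_decomp[of "act g (x n)" z] by simp
      finally show "fu (pref x (Suc n)) z = prep (tout \<delta> out (enc f) x (Suc n)) (strip (act g (x n)) z)"
        by (simp add: tout_Suc g(2) prep_append)
      show "length (tout \<delta> out (enc f) x (Suc n)) = split_level (fu (pref x (Suc n)))"
        by (simp add: tout_Suc g(2) out s(2))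
    qed
  qed
  show ?thesis
  proof (intro exI conjI)
    show "transducer (enc ` L) (enc f) \<delta>"
      unfolding transducer_def
    proof (intro conjI ballI allI)
      show "finite (enc ` L)" using \<open>finite L\<close> by simp
      show "enc f \<in> enc ` L" by (simp add: L_def)
      fix q b assume "q \<in> enc ` L"
      then obtain g where g: "g \<in> L" "q = enc g" by blast
      \<comment> \<open>Every state is the local map at some word up to a fixed prefix, so its
        stripped successors are stripped local maps again.\<close>
      have "\<exists>u w. \<forall>z. fu u z = prep w (g z)"
      proof (cases "g = f")
        case True
        then show ?thesis by (intro exI[of _ "[]"]) (simp add: fu_def)
      next
        case False
        then obtain u where "g = strip (fu u)" using g(1) by (auto simp: L_def)
        then have "\<forall>z. fu u z = prep (pref (fu u (\<lambda>_. False)) (split_level (fu u))) (g z)"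
          using strip_decomp[of "fu u"] by simp
        then show ?thesis by blast
      qed
      then obtain u w where "\<And>z. fu u z = prep w (g z)" by blast
      then have "strip (act g b) \<in> L" using strip_act[of u w g b] strip_L by simp
      then show "\<delta> q b \<in> enc ` L" using g by (simp add: \<delta>_def)
    qed
    show "computes \<delta> out (enc f) f"
      unfolding computes_def
    proof (intro allI impI)
      fix x n i assume i: "i < length (tout \<delta> out (enc f) x n)"
      obtain g where "\<And>z. fu (pref x n) z = prep (tout \<delta> out (enc f) x n) (g z)"
        using run by blast
      from this[of "shift n x"] have "f x = prep (tout \<delta> out (enc f) x n) (g (shift n x))"
        by (simp add: fu_def)
      then show "f x i = tout \<delta> out (enc f) x n ! i" using i by simp
    qed
    show "nondegenerate \<delta> out (enc f)"
      unfolding nondegenerate_def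
    proof (intro allI)
      fix x m
      obtain k where k: "f ` cyl UNIV (pref x k) \<subseteq> cyl UNIV (pref (f x) m)"
        using cont unfolding cyl_cont_def by (metis UNIV_I bdry_UNIV)
      \<comment> \<open>One letter more than continuity asks for, since \<open>run\<close> gives the
        output length only after at least one letter.\<close>
      have "m \<le> split_level (fu (pref x (Suc k)))"
      proof (rule split_level_ge)
        show "fu (pref x (Suc k)) (\<lambda>_. False) \<noteq> fu (pref x (Suc k)) (\<lambda>_. True)" by (rule fu_ne)
        have "fu (pref x (Suc k)) y n = f x n" if "n < m" for y n
        proof -
          have "prep (pref x (Suc k)) y \<in> cyl UNIV (pref x k)"
            using cyl_append_subset[of UNIV "pref x k" "[x k]"] prep_in_cyl[of "pref x (Suc k)" y]
            unfolding pref_Suc by blast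
          then have "fu (pref x (Suc k)) y \<in> cyl UNIV (pref (f x) m)" using k by (auto simp: fu_def)
          then show ?thesis using that by (simp add: mem_cyl_iff)
        qed
        then show "fu (pref x (Suc k)) y n = fu (pref x (Suc k)) y' n" if "n < m" for y y' n
          using that by simp
      qed
      then show "\<exists>n. m \<le> length (tout \<delta> out (enc f) x n)"
        using run[of x "Suc k"] by (metis zero_less_Suc)
    qed
  qed
qed

lemma R2_iff:
  "f \<in> R2 \<longleftrightarrow> (\<exists>g. cyl_homeo UNIV UNIV f g) \<and> tree_pair.finitary UNIV bmor UNIV bmor f"
proof -
  have "(\<exists>Q q0 \<delta> out. transducer Q q0 \<delta> \<and> nondegenerate \<delta> out q0 \<and> computes \<delta> out q0 f) \<longleftrightarrow>
      tree_pair.finitary UNIV bmor UNIV bmor f" if g: "cyl_homeo UNIV UNIV f g" for g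
    using transducer_imp_finitary finitary_imp_transducer[of f] g cyl_homeo_inj_on[OF g]
    unfolding cyl_homeo_def bdry_UNIV by metis
  then show ?thesis
    unfolding R2_def cantor_top_def homeomorphic_map_bdry_iff[OF rooted_tree_UNIV rooted_tree_UNIV]
    by blast
qed

section \<open>Boundary maps induced by morphisms\<close>

text \<open>Equality of types is built in because \<open>self_similar\<close> constrains
  \<open>Mor u v\<close> only for vertices of the same type.\<close>

definition tree_mor ::
  "'a list set \<Rightarrow> ('a list \<Rightarrow> nat) \<Rightarrow> ('a list \<Rightarrow> 'a list \<Rightarrow> ('a list \<Rightarrow> 'a list) set) \<Rightarrow>
   'a list \<Rightarrow> 'a list \<Rightarrow> ((nat \<Rightarrow> 'a) \<Rightarrow> (nat \<Rightarrow> 'a)) \<Rightarrow> bool" where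
  "tree_mor T tp Mor u v e \<longleftrightarrow> u \<in> T \<and> v \<in> T \<and> tp u = tp v \<and>
     (\<exists>\<phi>\<in>Mor u v. \<forall>p\<in>cyl T u. e p = induced \<phi> u p)"

lemma pref_in_subtree:
  assumes "p \<in> cyl T u"
  shows "pref p (length u + n) \<in> subtree T u"
proof -
  have "p \<in> bdry T" "pref p (length u) = u" using assms by (auto simp: cyl_def)
  then show ?thesis
    using pref_le[of "length u" "length u + n" p] by (auto simp: subtree_def bdry_def)
qed

text \<open>A morphism respects children, so it sends the vertices of a path to a chain as in
  \<open>pref_chain\<close>. Identities between induced maps thus reduce to identities between
  morphisms at vertices, even if \<open>u\<close> and \<open>v\<close> lie at different
  depths.\<close>

lemma pref_induced:
  assumes \<phi>: "tree_morphism T tp u v \<phi>" and p: "p \<in> cyl T u"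
  shows "pref (induced \<phi> u p) (length v + n) = \<phi> (pref p (length u + n))"
proof -
  have "pref p (length u) = u" using p by (simp add: cyl_def)
  then have "\<phi> (pref p (length u)) = v" using \<phi> by (simp add: tree_morphism_def)
  moreover have "\<exists>a. \<phi> (pref p (length u + Suc n)) = \<phi> (pref p (length u + n)) @ [a]" for n
  proof -
    have "is_child (pref p (length u + n)) (pref p (length u + Suc n))"
      by (simp add: is_child_def pref_Suc)
    then have "is_child (\<phi> (pref p (length u + n))) (\<phi> (pref p (length u + Suc n)))"
      using \<phi> pref_in_subtree[OF p, of n] pref_in_subtree[OF p, of "Suc n"]
      unfolding tree_morphism_def by blast
    then show ?thesis by (simp add: is_child_def)
  qed
  ultimately show ?thesis
    using pref_chain[of "\<lambda>n. \<phi> (pref p (length u + n))" n] by (simp add: induced_def)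
qed

lemma fun_eqI_pref:
  assumes "\<And>n. pref p (m + n) = pref q (m + n)"
  shows "p = q"
proof
  fix i
  have "pref p (m + Suc i) = pref q (m + Suc i)" by (rule assms)
  then show "p i = q i" unfolding pref_eq_iff by simp
qed

lemma induced_in_cyl:
  assumes T: "rooted_tree T" and \<phi>: "tree_morphism T tp u v \<phi>" and p: "p \<in> cyl T u"
  shows "induced \<phi> u p \<in> cyl T v"
proof -
  have pre: "pref (induced \<phi> u p) (length v + n) \<in> subtree T v" for n
    using pref_induced[OF \<phi> p] pref_in_subtree[OF p, of n] \<phi>
    unfolding tree_morphism_def bij_betw_def by auto
  have "induced \<phi> u p \<in> bdry T"
  proof (rule bdryI[OF T])
    show "pref (induced \<phi> u p) n \<in> T" if "length v \<le> n" for n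
      using pre[of "n - length v"] that by (simp add: subtree_def)
  qed
  moreover have "pref (induced \<phi> u p) (length v) = v"
    using pref_induced[OF \<phi> p, of 0] p \<phi> by (simp add: cyl_def tree_morphism_def)
  ultimately show ?thesis by (simp add: cyl_def)
qed

lemma tree_structure_tree_mor:
  assumes ss: "self_similar T tp Mor" and br: "branching T"
  shows "tree_structure T (tree_mor T tp Mor)"
proof -
  have rt: "rooted_tree T" and lf: "locally_finite T" and ft: "finite (tp ` T)"
    using ss by (auto simp: self_similar_def)
  have M: "finite (Mor u v)" "Mor u v \<noteq> {}" if "u \<in> T" "v \<in> T" "tp u = tp v" for u v
    using ss that by (simp_all add: self_similar_def)
  have Mt: "tree_morphism T tp u v \<phi>" if "u \<in> T" "v \<in> T" "tp u = tp v" "\<phi> \<in> Mor u v" for u v \<phi>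
    using ss that by (simp add: self_similar_def)
  have Mi: "restrict (inv_into (subtree T u) \<phi>) (subtree T v) \<in> Mor v u"
    if "u \<in> T" "v \<in> T" "tp u = tp v" "\<phi> \<in> Mor u v" for u v \<phi>
    using ss that by (simp add: self_similar_def)
  have Mc: "restrict (\<psi> \<circ> \<phi>) (subtree T u) \<in> Mor u w"
    if "u \<in> T" "v \<in> T" "w \<in> T" "tp u = tp v" "tp v = tp w" "\<phi> \<in> Mor u v" "\<psi> \<in> Mor v w" for u v w \<phi> \<psi>
    using ss that unfolding self_similar_def by blast
  have Mr: "restrict \<phi> (subtree T u) \<in> Mor u (\<phi> u)"
    if "v \<in> T" "w \<in> T" "tp v = tp w" "\<phi> \<in> Mor v w" "u \<in> subtree T v" for u v w \<phi>
    using ss that unfolding self_similar_def by blast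
  \<comment> \<open>The inverse morphism induces a map that undoes the one of \<open>\<phi>\<close>
    on every prefix. This gives bijectivity and also identifies \<open>inv_into\<close>, so two
    axioms come from one construction.\<close>
  have inverse: "bij_betw e (cyl T u) (cyl T v) \<and> tree_mor T tp Mor v u (inv_into (cyl T u) e)"
    if e: "tree_mor T tp Mor u v e" for u v e
  proof -
    obtain \<phi> where uv: "u \<in> T" "v \<in> T" "tp u = tp v" and \<phi>: "\<phi> \<in> Mor u v"
      and ep: "\<And>p. p \<in> cyl T u \<Longrightarrow> e p = induced \<phi> u p"
      using e unfolding tree_mor_def by blast
    define \<psi> where "\<psi> = restrict (inv_into (subtree T u) \<phi>) (subtree T v)"
    have \<psi>: "\<psi> \<in> Mor v u" unfolding \<psi>_def using uv \<phi> by (rule Mi)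
    have t\<phi>: "tree_morphism T tp u v \<phi>" using Mt uv \<phi> by blast
    have t\<psi>: "tree_morphism T tp v u \<psi>" using Mt uv \<psi> by simp
    have bij: "bij_betw \<phi> (subtree T u) (subtree T v)" using t\<phi> by (simp add: tree_morphism_def)
    have l: "induced \<psi> v (induced \<phi> u p) = p" if p: "p \<in> cyl T u" for p
    proof (rule fun_eqI_pref[where m = "length u"])
      fix n
      have s: "pref p (length u + n) \<in> subtree T u" using p by (rule pref_in_subtree)
      then have "\<psi> (\<phi> (pref p (length u + n))) = pref p (length u + n)"
        unfolding \<psi>_def using bij bij_betwE[OF bij] by (simp add: bij_betw_inv_into_left)
      then show "pref (induced \<psi> v (induced \<phi> u p)) (length u + n) = pref p (length u + n)"
        using pref_induced[OF t\<psi> induced_in_cyl[OF rt t\<phi> p]] pref_induced[OF t\<phi> p] by simp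
    qed
    have r: "induced \<phi> u (induced \<psi> v q) = q" if q: "q \<in> cyl T v" for q
    proof (rule fun_eqI_pref[where m = "length v"])
      fix n
      have s: "pref q (length v + n) \<in> subtree T v" using q by (rule pref_in_subtree)
      then have "\<phi> (\<psi> (pref q (length v + n))) = pref q (length v + n)"
        unfolding \<psi>_def using bij by (simp add: bij_betw_inv_into_right)
      then show "pref (induced \<phi> u (induced \<psi> v q)) (length v + n) = pref q (length v + n)"
        using pref_induced[OF t\<phi> induced_in_cyl[OF rt t\<psi> q]] pref_induced[OF t\<psi> q] by simp
    qed
    have b: "bij_betw e (cyl T u) (cyl T v)"
    proof (rule bij_betw_byWitness[where f' = "induced \<psi> v"])
      show "e ` cyl T u \<subseteq> cyl T v" using induced_in_cyl[OF rt t\<phi>] ep by auto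
      show "induced \<psi> v ` cyl T v \<subseteq> cyl T u" using induced_in_cyl[OF rt t\<psi>] by auto
      then show "\<forall>q\<in>cyl T v. e (induced \<psi> v q) = q" using r ep by auto
      show "\<forall>p\<in>cyl T u. induced \<psi> v (e p) = p" using l ep by simp
    qed
    have "inv_into (cyl T u) e q = induced \<psi> v q" if q: "q \<in> cyl T v" for q
    proof (rule inv_into_f_eq)
      show "inj_on e (cyl T u)" using b by (rule bij_betw_imp_inj_on)
      show "induced \<psi> v q \<in> cyl T u" using induced_in_cyl[OF rt t\<psi> q] .
      then show "e (induced \<psi> v q) = q" using r[OF q] ep by simp
    qed
    then show ?thesis using b uv \<psi> unfolding tree_mor_def by auto
  qed
  show ?thesis
  proof
    show "rooted_tree T" "locally_finite T" "branching T" by fact+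
    show "\<exists>R. finite R \<and> R \<subseteq> T \<and> (\<forall>v\<in>T. \<exists>r\<in>R. \<exists>e. tree_mor T tp Mor v r e)"
    proof (intro exI conjI ballI)
      show "finite (inv_into T tp ` tp ` T)" using ft by simp
      show "inv_into T tp ` tp ` T \<subseteq> T" by (auto intro: inv_into_into)
      fix v assume v: "v \<in> T"
      define r where "r = inv_into T tp (tp v)"
      have r: "r \<in> T" "tp v = tp r"
        unfolding r_def using v by (simp_all add: inv_into_into f_inv_into_f)
      then obtain \<phi> where "\<phi> \<in> Mor v r" using M(2) v by blast
      then have "tree_mor T tp Mor v r (induced \<phi> v)" unfolding tree_mor_def using v r by blast
      then show "\<exists>r\<in>inv_into T tp ` tp ` T. \<exists>e. tree_mor T tp Mor v r e"
        unfolding r_def using v by blast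
    qed
    fix u v e
    show "finite ((\<lambda>e. restrict e (cyl T u)) ` {e. tree_mor T tp Mor u v e})"
    proof (cases "u \<in> T \<and> v \<in> T \<and> tp u = tp v")
      case True
      show ?thesis
      proof (rule finite_subset)
        show "finite ((\<lambda>\<phi>. restrict (induced \<phi> u) (cyl T u)) ` Mor u v)" using M True by simp
        show "(\<lambda>e. restrict e (cyl T u)) ` {e. tree_mor T tp Mor u v e}
          \<subseteq> (\<lambda>\<phi>. restrict (induced \<phi> u) (cyl T u)) ` Mor u v"
        proof clarsimp
          fix e assume "tree_mor T tp Mor u v e"
          then obtain \<phi> where "\<phi> \<in> Mor u v" "\<forall>p\<in>cyl T u. e p = induced \<phi> u p"
            by (auto simp: tree_mor_def)
          then show "restrict e (cyl T u) \<in> (\<lambda>\<phi>. restrict (induced \<phi> u) (cyl T u)) ` Mor u v"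
            by (intro image_eqI[of _ _ \<phi>]) auto
        qed
      qed
    next
      case False
      then have "{e. tree_mor T tp Mor u v e} = {}" by (auto simp: tree_mor_def)
      then show ?thesis by simp
    qed
    assume e: "tree_mor T tp Mor u v e"
    show "bij_betw e (cyl T u) (cyl T v)" "tree_mor T tp Mor v u (inv_into (cyl T u) e)"
      using inverse[OF e] by auto
    show "u \<in> T \<and> v \<in> T" using e by (simp add: tree_mor_def)
    show "tree_mor T tp Mor u v e'" if "\<And>p. p \<in> cyl T u \<Longrightarrow> e' p = e p" for e'
      using e that unfolding tree_mor_def by simp
    obtain \<phi> where uv: "u \<in> T" "v \<in> T" "tp u = tp v" and \<phi>: "\<phi> \<in> Mor u v"
      and ep: "\<And>p. p \<in> cyl T u \<Longrightarrow> e p = induced \<phi> u p"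
      using e unfolding tree_mor_def by blast
    have t\<phi>: "tree_morphism T tp u v \<phi>" using Mt uv \<phi> by blast
    show "tree_mor T tp Mor u w (\<lambda>p. d (e p))" if d: "tree_mor T tp Mor v w d" for w d
    proof -
      obtain \<psi> where vw: "w \<in> T" "tp v = tp w" and \<psi>: "\<psi> \<in> Mor v w"
        and dp: "\<And>p. p \<in> cyl T v \<Longrightarrow> d p = induced \<psi> v p"
        using d unfolding tree_mor_def by blast
      define \<chi> where "\<chi> = restrict (\<psi> \<circ> \<phi>) (subtree T u)"
      have \<chi>: "\<chi> \<in> Mor u w" unfolding \<chi>_def using Mc[OF uv(1,2) vw(1) uv(3) vw(2) \<phi> \<psi>] .
      have t\<psi>: "tree_morphism T tp v w \<psi>" using Mt uv vw \<psi> by blast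
      have t\<chi>: "tree_morphism T tp u w \<chi>" using Mt uv vw \<chi> by simp
      have "d (e p) = induced \<chi> u p" if p: "p \<in> cyl T u" for p
      proof (rule fun_eqI_pref[where m = "length w"])
        fix n
        have i: "induced \<phi> u p \<in> cyl T v" using induced_in_cyl[OF rt t\<phi> p] .
        then have "d (e p) = induced \<psi> v (induced \<phi> u p)" using ep[OF p] dp by simp
        then show "pref (d (e p)) (length w + n) = pref (induced \<chi> u p) (length w + n)"
          using pref_induced[OF t\<psi> i, of n] pref_induced[OF t\<phi> p, of n] pref_induced[OF t\<chi> p, of n]
            pref_in_subtree[OF p, of n] by (simp add: \<chi>_def)
      qed
      then show ?thesis unfolding tree_mor_def using uv vw \<chi> by auto
    qed
    show "\<exists>z'. length z' = length z \<and> tree_mor T tp Mor (u @ z) (v @ z') e" if z: "u @ z \<in> T" for z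
    proof -
      \<comment> \<open>A path through \<open>u @ z\<close> locates \<open>\<phi> (u @ z)\<close>:
        it is a prefix of the image path, hence extends \<open>v\<close> by as many letters as
        \<open>z\<close> has.\<close>
      obtain p where p: "p \<in> cyl T (u @ z)" using cyl_nonempty[OF rt br z] .
      have us: "u @ z \<in> subtree T u" using z by (auto simp: subtree_def)
      have sub: "cyl T (u @ z) \<subseteq> cyl T u" by (rule cyl_append_subset)
      have "pref (induced \<phi> u p) (length v + length z) = \<phi> (u @ z)"
        using pref_induced[OF t\<phi>, of p "length z"] p sub by (auto simp: cyl_def)
      moreover have "pref (induced \<phi> u p) (length v) = v"
        using induced_in_cyl[OF rt t\<phi>, of p] p sub by (auto simp: cyl_def)
      ultimately obtain z' where z': "\<phi> (u @ z) = v @ z'" "length z' = length z"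
        using pref_le[of "length v" "length v + length z" "induced \<phi> u p"]
        by (metis add_left_cancel le_add1 length_append length_pref)
      define \<chi> where "\<chi> = restrict \<phi> (subtree T (u @ z))"
      have \<chi>: "\<chi> \<in> Mor (u @ z) (v @ z')" using Mr[OF uv \<phi> us] z' by (simp add: \<chi>_def)
      have "\<phi> (u @ z) \<in> subtree T v" "tp (\<phi> (u @ z)) = tp (u @ z)"
        using t\<phi> us bij_betwE[of \<phi> "subtree T u" "subtree T v"] by (simp_all add: tree_morphism_def)
      then have vz: "v @ z' \<in> T" "tp (u @ z) = tp (v @ z')"
        unfolding z'(1) by (simp_all add: subtree_def)
      have t\<chi>: "tree_morphism T tp (u @ z) (v @ z') \<chi>" using Mt z vz \<chi> by blast
      have "e q = induced \<chi> (u @ z) q" if q: "q \<in> cyl T (u @ z)" for q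
      proof (rule fun_eqI_pref[where m = "length (v @ z')"])
        fix n
        have qu: "q \<in> cyl T u" using q sub by blast
        have "pref (e q) (length v + (length z' + n)) = \<phi> (pref q (length u + (length z + n)))"
          using pref_induced[OF t\<phi> qu, of "length z' + n"] ep[OF qu] z'(2) by simp
        also have "\<dots> = \<chi> (pref q (length (u @ z) + n))"
          using pref_in_subtree[OF q, of n] by (simp add: \<chi>_def add.assoc)
        also have "\<dots> = pref (induced \<chi> (u @ z) q) (length (v @ z') + n)"
          using pref_induced[OF t\<chi> q, of n] by simp
        finally show "pref (e q) (length (v @ z') + n) = pref (induced \<chi> (u @ z) q) (length (v @ z') + n)"
          by (simp add: add.assoc)
      qed
      then have "tree_mor T tp Mor (u @ z) (v @ z') e"
        unfolding tree_mor_def using z vz \<chi> by auto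
      then show ?thesis using z'(2) by blast
    qed
  qed
qed

text \<open>Witnesses \<open>e\<close>, \<open>d\<close> may differ from induced maps off their
  cylinders, but this is never seen, since \<open>f\<close> sends the cylinder of \<open>v\<close>
  into that of \<open>x\<close>.\<close>

lemma rational_iff_finitary:
  assumes ss: "self_similar T tp Mor" "branching T" and f: "f ` bdry T \<subseteq> bdry T"
  shows "rational T tp Mor T tp Mor f \<longleftrightarrow>
    tree_pair.finitary T (tree_mor T tp Mor) T (tree_mor T tp Mor) f"
proof -
  interpret S: tree_structure T "tree_mor T tp Mor" by (rule tree_structure_tree_mor[OF ss])
  interpret tree_pair T "tree_mor T tp Mor" T "tree_mor T tp Mor" f
    using f by unfold_locales
  have "tp v = tp w \<and> equiv_restr T tp Mor T tp Mor f v w \<longleftrightarrow> vrel v w"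
    if vw: "v \<in> T" "w \<in> T" for v w
  proof
    assume L: "tp v = tp w \<and> equiv_restr T tp Mor T tp Mor f v w"
    then obtain x y \<phi> \<psi> where 1: "x \<in> T" "y \<in> T" "\<phi> \<in> Mor v w" "\<psi> \<in> Mor x y" "tp x = tp y"
        "f ` cyl T v \<subseteq> cyl T x" "f ` cyl T w \<subseteq> cyl T y"
        "\<forall>p\<in>cyl T v. f (induced \<phi> v p) = induced \<psi> x (f p)"
      unfolding equiv_restr_def by (elim conjE bexE) (rule that)
    have "tree_mor T tp Mor v w (induced \<phi> v)" "tree_mor T tp Mor x y (induced \<psi> x)"
      using L vw 1(1-5) by (auto simp: tree_mor_def)
    then have "via v w (induced \<phi> v) x y (induced \<psi> x)"
      using 1(6-8) unfolding via_def by simp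
    then show "vrel v w" unfolding vrel_def by blast
  next
    assume "vrel v w"
    then obtain e x y d where v: "via v w e x y d" unfolding vrel_def by blast
    then obtain \<phi> \<psi> where 1: "x \<in> T" "y \<in> T" "\<phi> \<in> Mor v w" "\<psi> \<in> Mor x y" "tp x = tp y" "tp v = tp w"
        "\<And>p. p \<in> cyl T v \<Longrightarrow> e p = induced \<phi> v p" "\<And>p. p \<in> cyl T x \<Longrightarrow> d p = induced \<psi> x p"
      unfolding via_def tree_mor_def by (elim conjE bexE) (rule that, simp_all)
    have "f (induced \<phi> v p) = induced \<psi> x (f p)" if p: "p \<in> cyl T v" for p
    proof -
      have "f p \<in> cyl T x" using v p by (auto simp: via_def)
      moreover have "f (e p) = d (f p)" using v p by (auto simp: via_def)
      ultimately show ?thesis using 1(7)[OF p] 1(8) by simp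
    qed
    moreover have "f ` cyl T v \<subseteq> cyl T x" "f ` cyl T w \<subseteq> cyl T y" using v by (simp_all add: via_def)
    ultimately show "tp v = tp w \<and> equiv_restr T tp Mor T tp Mor f v w"
      using 1(1-6) unfolding equiv_restr_def by (intro conjI bexI[of _ x] bexI[of _ y] bexI[of _ \<phi>] bexI[of _ \<psi>]) auto
  qed
  then have "{(v, w). v \<in> T \<and> w \<in> T \<and> tp v = tp w \<and> equiv_restr T tp Mor T tp Mor f v w} =
      {(v, w). v \<in> T \<and> w \<in> T \<and> vrel v w}" by auto
  then show ?thesis unfolding rational_def finitary_iff_finite_quotient by simp
qed

section \<open>Coding the boundary by binary sequences\<close>

text \<open>The infinite concatenation of the words emitted at \<open>s\<close>,
  \<open>nx s\<close>, and so on. An empty word would stall the recursion, so it stops there with an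
  unspecified letter; \<open>catseq_unfold\<close> speaks of nonempty words only.\<close>

function catseq :: "('s \<Rightarrow> 'c list) \<Rightarrow> ('s \<Rightarrow> 's) \<Rightarrow> 's \<Rightarrow> nat \<Rightarrow> 'c" where
  "catseq out nx s i =
    (if i < length (out s) \<or> out s = [] then out s ! i else catseq out nx (nx s) (i - length (out s)))"
  by pat_completeness auto
termination
proof (relation "measure (\<lambda>(_, _, _, i). i)")
  fix out :: "'s \<Rightarrow> 'c list" and nx :: "'s \<Rightarrow> 's" and s i
  assume "\<not> (i < length (out s) \<or> out s = [])"
  then have "0 < length (out s)" "length (out s) \<le> i" by auto
  then have "i - length (out s) < i" by linarith
  then show "((out, nx, nx s, i - length (out s)), (out, nx, s, i)) \<in> measure (\<lambda>(_, _, _, i). i)"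
    by simp
qed simp

declare catseq.simps [simp del]

lemma catseq_unfold:
  assumes "out s \<noteq> []"
  shows "catseq out nx s = prep (out s) (catseq out nx (nx s))"
proof
  show "catseq out nx s i = prep (out s) (catseq out nx (nx s)) i" for i
    using assms by (subst catseq.simps) (simp add: prep_def)
qed

lemma mem_cyl_Cons: "z \<in> cyl UNIV (c # w) \<longleftrightarrow> z 0 = c \<and> shift 1 z \<in> cyl UNIV w"
  by (auto simp: mem_cyl_iff shift_def All_less_Suc2)

text \<open>The unary code 0, 10, 110 and so on, closed off by a word of ones. Uniqueness says that
  the code is prefix free, existence that it is complete. A single element gets the empty
  word.\<close>

lemma complete_prefix_code_exists:
  fixes S :: "'b set"
  assumes "finite S" "S \<noteq> {}"
  shows "\<exists>code :: 'b \<Rightarrow> bool list. \<forall>z. \<exists>!s. s \<in> S \<and> z \<in> cyl UNIV (code s)"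
  using assms
proof (induction rule: finite_ne_induct)
  case (singleton a)
  show ?case by (intro exI[of _ "\<lambda>_. []"]) simp
next
  case (insert a F)
  then obtain code where code: "\<And>z. \<exists>!s. s \<in> F \<and> z \<in> cyl UNIV (code s :: bool list)" by blast
  define code' where "code' s = (if s = a then [False] else True # code s)" for s
  have "\<exists>!s. s \<in> insert a F \<and> z \<in> cyl UNIV (code' s)" for z
  proof (cases "z 0")
    case True
    then have "s \<in> insert a F \<and> z \<in> cyl UNIV (code' s) \<longleftrightarrow> s \<in> F \<and> shift 1 z \<in> cyl UNIV (code s)" for s
      using insert.hyps by (auto simp: code'_def mem_cyl_Cons)
    then show ?thesis using code[of "shift 1 z"] by simp
  next
    case False
    then have "s \<in> insert a F \<and> z \<in> cyl UNIV (code' s) \<longleftrightarrow> s = a" for s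
      by (auto simp: code'_def mem_cyl_Cons)
    then show ?thesis by simp
  qed
  then show ?case by blast
qed

text \<open>The homeomorphism \<open>h\<close> reads a boundary point letter by letter, emitting at each vertex a word
  of a prefix code of the children and then moving by a chosen morphism to the representative of
  the child that was entered. Hence on the cylinder of \<open>v\<close> it is a fixed word \<open>w\<close> followed by a map
  depending on the representative \<open>r\<close> of \<open>v\<close> only (the predicate \<open>Coh\<close>).\<close>

lemma finitary_homeo_to_binary:
  fixes T :: "'a list set"
  assumes "tree_structure T mor"
  obtains h g where "cyl_homeo T UNIV h g" "tree_pair.finitary T mor UNIV bmor h"
proof -
  interpret S: tree_structure T mor by fact
  obtain R where R: "finite R" "R \<subseteq> T" "\<forall>v\<in>T. \<exists>r\<in>R. \<exists>e. mor v r e"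
    using S.fin_reps by blast
  then have "\<forall>v\<in>T. \<exists>r. r \<in> R \<and> (\<exists>e. mor v r e)" by blast
  from bchoice[OF this] obtain \<rho> where \<rho>1: "\<And>v. v \<in> T \<Longrightarrow> \<rho> v \<in> R \<and> (\<exists>e. mor v (\<rho> v) e)"
    by auto
  then have "\<forall>v\<in>T. \<exists>e. mor v (\<rho> v) e" by simp
  from bchoice[OF this] obtain \<epsilon> where \<epsilon>: "\<And>v. v \<in> T \<Longrightarrow> mor v (\<rho> v) (\<epsilon> v)"
    by auto
  have \<rho>: "\<rho> v \<in> R" "mor v (\<rho> v) (\<epsilon> v)" if "v \<in> T" for v
    using \<rho>1[OF that] \<epsilon>[OF that] by simp_all
  have "\<forall>r. \<exists>c :: 'a \<Rightarrow> bool list. r \<in> T \<longrightarrow> (\<forall>z. \<exists>!a. r @ [a] \<in> T \<and> z \<in> cyl UNIV (c a))"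
  proof
    fix r
    show "\<exists>c :: 'a \<Rightarrow> bool list. r \<in> T \<longrightarrow> (\<forall>z. \<exists>!a. r @ [a] \<in> T \<and> z \<in> cyl UNIV (c a))"
    proof (cases "r \<in> T")
      case True
      then have "finite {a. r @ [a] \<in> T}" "{a. r @ [a] \<in> T} \<noteq> {}"
        using S.locfin S.branch by (auto simp: locally_finite_def branching_def)
      from complete_prefix_code_exists[OF this] show ?thesis by simp
    qed simp
  qed
  from choice[OF this] obtain cd :: "'a list \<Rightarrow> 'a \<Rightarrow> bool list"
    where "\<forall>r. r \<in> T \<longrightarrow> (\<forall>z. \<exists>!a. r @ [a] \<in> T \<and> z \<in> cyl UNIV (cd r a))" ..
  then have cd: "\<exists>!a. r @ [a] \<in> T \<and> z \<in> cyl UNIV (cd r a)" if "r \<in> T" for r z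
    using that by simp
  have cd_unique: "a = b" if "r @ [a] \<in> T" "r @ [b] \<in> T" "z \<in> cyl UNIV (cd r a)" "z \<in> cyl UNIV (cd r b)"
    for r a b z
    using cd[of r z] rooted_prefix[OF S.rooted that(1)] that by blast
  have cd_ne: "cd r a \<noteq> []" if ra: "r @ [a] \<in> T" for r a
  proof
    assume "cd r a = []"
    \<comment> \<open>The cylinder of the empty word is everything, so it would leave no room for
      the code word of a second child.\<close>
    then have "prep (cd r b) z \<in> cyl UNIV (cd r a)" for b z by simp
    moreover have "r \<in> T" using S.rooted ra by (rule rooted_prefix)
    ultimately have "b = a" if "r @ [b] \<in> T" for b
      using cd_unique[OF that ra, of "prep (cd r b) undefined"] by simp
    then show False using S.branch \<open>r \<in> T\<close> unfolding branching_def by metis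
  qed
  \<comment> \<open>A state is a representative \<open>r\<close> with a point of its cylinder.
    Representatives are not moved to the root, so the letter read next has index
    \<open>length r\<close>.\<close>
  define out where "out = (\<lambda>(r, p). cd r (p (length r)))"
  define nx where "nx = (\<lambda>(r, p). (\<rho> (r @ [p (length r)]), \<epsilon> (r @ [p (length r)]) p))"
  define H where "H r p = catseq out nx (r, p)" for r p
  have H_step: "H r p = prep (cd r b) (H (\<rho> (r @ [b])) (\<epsilon> (r @ [b]) p))"
    if p: "p \<in> cyl T (r @ [b])" for r b p
  proof -
    have b: "p (length r) = b" using p by (simp add: mem_cyl_iff)
    have "cd r b \<noteq> []" using cd_ne cyl_in_tree[OF p] .
    then show ?thesis
      unfolding H_def using catseq_unfold[of out "(r, p)" nx] by (simp add: out_def nx_def b)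
  qed
  define h where "h p = H (\<rho> []) (\<epsilon> [] p)" for p
  \<comment> \<open>The bound on \<open>length w\<close> records that no code word is empty: output
    grows with depth, which later gives continuity of \<open>h\<close>.\<close>
  define Coh where "Coh v w r e \<longleftrightarrow> r \<in> R \<and> mor v r e \<and> length v \<le> length w \<and>
      (\<forall>p\<in>cyl T v. h p = prep w (H r (e p)))" for v w r e
  have Coh_Nil: "Coh [] [] (\<rho> []) (\<epsilon> [])"
    using \<rho>[OF S.root_in] by (simp add: Coh_def h_def)
  have Coh_child: "Coh (v @ [a]) (w @ cd r b) (\<rho> (r @ [b])) (\<lambda>p. \<epsilon> (r @ [b]) (e p))"
    if C: "Coh v w r e" and m: "mor (v @ [a]) (r @ [b]) e" for v w r e a b
  proof -
    have rb: "r @ [b] \<in> T" using S.mor_in[OF m] by simp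
    then have l: "length (v @ [a]) \<le> length (w @ cd r b)"
      using C cd_ne[OF rb] by (cases "cd r b") (auto simp: Coh_def)
    have "h p = prep (w @ cd r b) (H (\<rho> (r @ [b])) (\<epsilon> (r @ [b]) (e p)))"
      if p: "p \<in> cyl T (v @ [a])" for p
    proof -
      have "p \<in> cyl T v" using p cyl_append_subset by blast
      then have "h p = prep w (H r (e p))" using C by (simp add: Coh_def)
      also have "H r (e p) = prep (cd r b) (H (\<rho> (r @ [b])) (\<epsilon> (r @ [b]) (e p)))"
        by (rule H_step) (rule S.mor_mem[OF m p])
      finally show ?thesis by (simp add: prep_append)
    qed
    then show ?thesis
      unfolding Coh_def using \<rho>[OF rb] S.mor_comp[OF m \<rho>(2)[OF rb]] l by simp
  qed
  have child: "\<exists>b. mor (v @ [a]) (r @ [b]) e" if "mor v r e" "v @ [a] \<in> T" for v r e a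
    using S.mor_restr[OF that] by (auto simp: length_Suc_conv)
  have Coh_ex: "\<exists>w r e. Coh v w r e" if "v \<in> T" for v
    using that
  proof (induction v rule: rev_induct)
    case Nil
    show ?case using Coh_Nil by blast
  next
    case (snoc a v)
    then obtain w r e where C: "Coh v w r e"
      using rooted_prefix[OF S.rooted snoc.prems] by blast
    then obtain b where "mor (v @ [a]) (r @ [b]) e"
      using child[of v r e a] snoc.prems by (auto simp: Coh_def)
    from Coh_child[OF C this] show ?case by blast
  qed
  have Coh_image: "h ` cyl T v = cyl UNIV w" if C: "Coh v w r e" for v w r e
  proof
    show "h ` cyl T v \<subseteq> cyl UNIV w" using C by (auto simp: Coh_def)
    show "cyl UNIV w \<subseteq> h ` cyl T v"
    proof
      fix z assume z: "z \<in> cyl UNIV w"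
      \<comment> \<open>The word emitted along \<open>u\<close> is a prefix of \<open>z\<close>.
        Completeness of the code always provides a next letter, and the resulting path is a preimage
        of \<open>z\<close>.\<close>
      define P where "P u \<longleftrightarrow> (\<exists>w r e. Coh u w r e \<and> z \<in> cyl UNIV w)" for u
      have "P v" unfolding P_def using C z by blast
      moreover have "\<exists>a. P (u @ [a])" if Pu: "P u" for u
      proof -
        obtain w r e where C: "Coh u w r e" and z: "z \<in> cyl UNIV w"
          using Pu unfolding P_def by blast
        have m: "mor u r e" using C by (simp add: Coh_def)
        obtain z' where z': "z = prep w z'" using z by (auto simp: cyl_UNIV)
        obtain b where b: "r @ [b] \<in> T" "z' \<in> cyl UNIV (cd r b)"
          using cd[of r z'] S.mor_in[OF m] by blast
        obtain e' where e': "mor r u e'" "\<And>q. q \<in> cyl T r \<Longrightarrow> e (e' q) = q"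
          using S.mor_inverse[OF m] by metis
        obtain a where a: "mor (r @ [b]) (u @ [a]) e'" using child[OF e'(1) b(1)] by blast
        obtain e'' where e'': "mor (u @ [a]) (r @ [b]) e''"
            "\<And>p. p \<in> cyl T (u @ [a]) \<Longrightarrow> e' (e'' p) = p"
          using S.mor_inverse[OF a] by metis
        \<comment> \<open>Here a child of \<open>r\<close> is given and one of \<open>u\<close> is
          sought, so \<open>child\<close> is applied to the inverse \<open>e'\<close>. Inverting
          back yields \<open>e''\<close>, which \<open>mor_cong\<close> replaces by
          \<open>e\<close>.\<close>
        have "e p = e'' p" if p: "p \<in> cyl T (u @ [a])" for p
        proof -
          have "e'' p \<in> cyl T r"
            using S.mor_mem[OF e''(1) p] cyl_append_subset[of T r "[b]"] by blast
          then show ?thesis using e'(2)[of "e'' p"] e''(2)[OF p] by simp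
        qed
        then have "mor (u @ [a]) (r @ [b]) e" using S.mor_cong[OF e''(1)] by simp
        from Coh_child[OF C this] have "Coh (u @ [a]) (w @ cd r b) (\<rho> (r @ [b])) (\<lambda>p. \<epsilon> (r @ [b]) (e p))" .
        moreover have "z \<in> cyl UNIV (w @ cd r b)"
          using b(2) unfolding z' by (auto simp: cyl_UNIV prep_append)
        ultimately show ?thesis unfolding P_def by blast
      qed
      ultimately obtain p where p: "pref p (length v) = v" "\<And>n. length v \<le> n \<Longrightarrow> P (pref p n)"
        using path_extend[of P v] by metis
      have PT: "pref p n \<in> T" if n: "length v \<le> n" for n
      proof -
        obtain w r e where "Coh (pref p n) w r e" using p(2)[OF n] unfolding P_def by blast
        then show ?thesis using S.mor_in[of "pref p n" r e] by (simp add: Coh_def)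
      qed
      have pT: "p \<in> bdry T" using S.rooted PT by (rule bdryI)
      have "h p = z"
      proof
        fix i
        obtain w r e where w: "Coh (pref p (length v + Suc i)) w r e" "z \<in> cyl UNIV w"
          using p(2)[of "length v + Suc i"] unfolding P_def by auto
        then have "h p \<in> cyl UNIV w" using mem_cyl_pref[OF pT] by (auto simp: Coh_def)
        moreover have "i < length w" using w(1) by (simp add: Coh_def)
        ultimately show "h p i = z i" using w(2) by (simp add: mem_cyl_iff)
      qed
      moreover have "p \<in> cyl T v" using pT p(1) by (simp add: cyl_def)
      ultimately show "z \<in> h ` cyl T v" by blast
    qed
  qed
  have inj: "p = q" if pq: "p \<in> bdry T" "q \<in> bdry T" "h p = h q" for p q
  proof (rule ccontr)
    assume "p \<noteq> q"
    then have "\<exists>n. p n \<noteq> q n" by auto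
    then obtain n where n: "p n \<noteq> q n" "\<And>i. i < n \<Longrightarrow> p i = q i"
      using exists_least_iff[of "\<lambda>n. p n \<noteq> q n"] by auto
    define v where "v = pref p n"
    have pv: "p \<in> cyl T (v @ [p n])" and qv: "q \<in> cyl T (v @ [q n])"
      using mem_cyl_pref[OF pq(1), of "Suc n"] mem_cyl_pref[OF pq(2), of "Suc n"] n(2)
      by (simp_all add: v_def pref_Suc pref_eq_iff[of p n q, THEN iffD2])
    then have v: "v @ [p n] \<in> T" "v @ [q n] \<in> T" using cyl_in_tree by blast+
    obtain w r e where C: "Coh v w r e" using Coh_ex rooted_prefix[OF S.rooted v(1)] by blast
    then have m: "mor v r e" by (simp add: Coh_def)
    obtain b where b: "mor (v @ [p n]) (r @ [b]) e" using child[OF m v(1)] by blast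
    obtain c where c: "mor (v @ [q n]) (r @ [c]) e" using child[OF m v(2)] by blast
    have "h p \<in> cyl UNIV (w @ cd r b)" using Coh_image[OF Coh_child[OF C b]] pv by blast
    moreover have "h q \<in> cyl UNIV (w @ cd r c)" using Coh_image[OF Coh_child[OF C c]] qv by blast
    ultimately obtain y z where "h p = prep w (prep (cd r b) y)" "h q = prep w (prep (cd r c) z)"
      by (auto simp: cyl_UNIV prep_append)
    then have "prep (cd r b) y = prep (cd r c) z" using pq(3) by simp
    then have "prep (cd r b) y \<in> cyl UNIV (cd r b)" "prep (cd r b) y \<in> cyl UNIV (cd r c)"
      by (metis prep_in_cyl)+
    \<comment> \<open>The code words of \<open>b\<close> and \<open>c\<close> have a common
      continuation, so the children of \<open>v\<close> entered by \<open>p\<close> and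
      \<open>q\<close> go to one child of \<open>r\<close>; injectivity of \<open>e\<close> on the
      cylinder of \<open>v\<close> forbids this.\<close>
    then have bc: "b = c"
      using cd_unique[of r b c "prep (cd r b) y"] S.mor_in[OF b] S.mor_in[OF c] by blast
    have "e q \<in> cyl T (r @ [b])" using S.mor_mem[OF c qv] bc by simp
    then have "e q \<in> e ` cyl T (v @ [p n])" using S.mor_image[OF b] by simp
    then obtain q' where q': "q' \<in> cyl T (v @ [p n])" "e q = e q'" by (rule imageE)
    have "q \<in> cyl T v" "q' \<in> cyl T v" using q'(1) qv cyl_append_subset by blast+
    then have "q = q'"
      using q'(2) S.mor_bij[OF m] by (meson bij_betw_imp_inj_on inj_onD)
    then show False using q'(1) n(1) by (simp add: mem_cyl_iff v_def nth_append)
  qed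
  define g where "g = inv_into (bdry T) h"
  have surj: "h ` bdry T = UNIV" using Coh_image[OF Coh_Nil] by simp
  have g: "g z \<in> bdry T" "h (g z) = z" for z
    unfolding g_def using surj by (simp_all add: inv_into_into f_inv_into_f)
  have gh: "g (h p) = p" if "p \<in> bdry T" for p
    using inj[of "g (h p)" p] g that by simp
  have "cyl_homeo T UNIV h g"
    unfolding cyl_homeo_def
  proof (intro conjI ballI)
    show "cyl_cont T UNIV h"
      unfolding cyl_cont_def
    proof (intro ballI allI)
      fix p n assume p: "p \<in> bdry T"
      obtain w r e where C: "Coh (pref p n) w r e"
        using Coh_ex[OF cyl_in_tree[OF mem_cyl_pref[OF p]]] by blast
      have "h p \<in> cyl UNIV w" using Coh_image[OF C] mem_cyl_pref[OF p] by blast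
      then have "w = pref (h p) (length w)" by (simp add: cyl_def)
      moreover have "n \<le> length w" using C by (simp add: Coh_def)
      ultimately have "cyl UNIV w \<subseteq> cyl UNIV (pref (h p) n)" by (metis cyl_pref_antimono)
      then show "\<exists>m. h ` cyl T (pref p m) \<subseteq> cyl UNIV (pref (h p) n)"
        using Coh_image[OF C] by blast
    qed
    show "cyl_cont UNIV T g"
      unfolding cyl_cont_def
    proof (intro ballI allI)
      fix z n
      obtain w r e where C: "Coh (pref (g z) n) w r e"
        using Coh_ex[OF cyl_in_tree[OF mem_cyl_pref[OF g(1)]]] by blast
      have "h (g z) \<in> cyl UNIV w" using Coh_image[OF C] mem_cyl_pref[OF g(1)] by blast
      then have "w = pref z (length w)" by (simp add: cyl_def g)
      moreover have "g ` cyl UNIV w \<subseteq> cyl T (pref (g z) n)"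
      proof -
        have "g (h p) = p" if "p \<in> cyl T (pref (g z) n)" for p
          using gh that cyl_subset_bdry by blast
        then show ?thesis unfolding Coh_image[OF C, symmetric] by auto
      qed
      ultimately show "\<exists>m. g ` cyl UNIV (pref z m) \<subseteq> cyl T (pref (g z) n)" by metis
    qed
  qed (use g gh in auto)
  moreover have "tree_pair.finitary T mor UNIV bmor h"
  proof -
    interpret tree_pair T mor UNIV bmor h by unfold_locales simp
    have "\<forall>v. \<exists>r. v \<in> T \<longrightarrow> (\<exists>w e. Coh v w r e)" using Coh_ex by blast
    from choice[OF this] obtain key where key: "\<And>v. v \<in> T \<Longrightarrow> \<exists>w e. Coh v w (key v) e" by blast
    show ?thesis
    proof (rule finitary_if_key)
      have "key ` T \<subseteq> R" using key unfolding Coh_def by blast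
      then show "finite (key ` T)" using R(1) by (rule finite_subset)
      fix v v' assume v: "v \<in> T" "v' \<in> T" "key v = key v'"
      obtain w e where C: "Coh v w (key v) e" using key v(1) by blast
      obtain w' e' where C': "Coh v' w' (key v) e'" using key v(2,3) by metis
      have m: "mor v (key v) e" "mor v' (key v) e'" using C C' by (simp_all add: Coh_def)
      obtain d where d: "mor (key v) v' d" "\<And>q. q \<in> cyl T (key v) \<Longrightarrow> e' (d q) = q"
        using S.mor_inverse[OF m(2)] by metis
      have "h (d (e p)) = prep w' (shift (length w) (h p))" if p: "p \<in> cyl T v" for p
      proof -
        have ep: "e p \<in> cyl T (key v)" using S.mor_mem[OF m(1) p] .
        then have "h (d (e p)) = prep w' (H (key v) (e' (d (e p))))"
          using C' S.mor_mem[OF d(1) ep] by (simp add: Coh_def)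
        moreover have "h p = prep w (H (key v) (e p))" using C p by (simp add: Coh_def)
        ultimately show ?thesis using d(2)[OF ep] by simp
      qed
      then have "via v v' (\<lambda>p. d (e p)) w w' (\<lambda>p. prep w' (shift (length w) p))"
        unfolding via_def using S.mor_comp[OF m(1) d(1)] Coh_image[OF C] Coh_image[OF C']
        by (simp add: bmor_shift)
      then show "vrel v v'" unfolding vrel_def by blast
    qed
  qed
  ultimately show ?thesis by (rule that)
qed

section \<open>The groups\<close>

text \<open>The arrows of a groupoid whose objects are the tree structures; group laws and
  conjugation both become instances of its inversion and composition.\<close>

definition fin_homeo ::
  "'a list set \<Rightarrow> ('a list \<Rightarrow> 'a list \<Rightarrow> ((nat \<Rightarrow> 'a) \<Rightarrow> (nat \<Rightarrow> 'a)) \<Rightarrow> bool) \<Rightarrow>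
   'b list set \<Rightarrow> ('b list \<Rightarrow> 'b list \<Rightarrow> ((nat \<Rightarrow> 'b) \<Rightarrow> (nat \<Rightarrow> 'b)) \<Rightarrow> bool) \<Rightarrow>
   ((nat \<Rightarrow> 'a) \<Rightarrow> (nat \<Rightarrow> 'b)) \<Rightarrow> ((nat \<Rightarrow> 'b) \<Rightarrow> (nat \<Rightarrow> 'a)) \<Rightarrow> bool" where
  "fin_homeo T mor T' mor' f g \<longleftrightarrow> tree_structure T mor \<and> tree_structure T' mor' \<and>
     cyl_homeo T T' f g \<and> tree_pair.finitary T mor T' mor' f"

lemma fin_homeo_pair: "fin_homeo T mor T' mor' f g \<Longrightarrow> tree_pair T mor T' mor' f"
  unfolding fin_homeo_def tree_pair_def tree_pair_axioms_def cyl_homeo_def by blast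

lemma fin_homeo_cong:
  assumes fg: "fin_homeo T mor T' mor' f g"
    and eq: "\<And>p. p \<in> bdry T \<Longrightarrow> f' p = f p" "\<And>q. q \<in> bdry T' \<Longrightarrow> g' q = g q"
  shows "fin_homeo T mor T' mor' f' g'"
  using fg cyl_homeo_cong[of T T' f g f' g'] finitary_cong[OF fin_homeo_pair[OF fg]] eq
  unfolding fin_homeo_def by simp

lemma fin_homeo_sym: "fin_homeo T mor T' mor' f g \<Longrightarrow> fin_homeo T' mor' T mor g f"
  using finitary_inverse[OF fin_homeo_pair] cyl_homeo_sym unfolding fin_homeo_def by blast

lemma fin_homeo_comp:
  assumes f: "fin_homeo T mor T' mor' f f'" and g: "fin_homeo T' mor' T'' mor'' g g'"
  shows "fin_homeo T mor T'' mor'' (\<lambda>p. g (f p)) (\<lambda>p. f' (g' p))"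
proof -
  have "inj_on f (bdry T)" "inj_on g (bdry T')"
    using f g cyl_homeo_inj_on unfolding fin_homeo_def by blast+
  then show ?thesis
    using finitary_comp[OF fin_homeo_pair[OF f] fin_homeo_pair[OF g]]
      cyl_homeo_comp[of T T' f f' T'' g g'] f g
    unfolding fin_homeo_def by simp
qed

lemma RT_iff:
  assumes ss: "self_similar T tp Mor" "branching T"
  defines "mor \<equiv> tree_mor T tp Mor"
  shows "f \<in> RT T tp Mor \<longleftrightarrow> f \<in> extensional (bdry T) \<and> (\<exists>g. fin_homeo T mor T mor f g)"
proof -
  have ts: "tree_structure T mor" unfolding mor_def by (rule tree_structure_tree_mor[OF ss])
  then have rt: "rooted_tree T" by (rule tree_structure.rooted)
  have "rational T tp Mor T tp Mor f \<longleftrightarrow> tree_pair.finitary T mor T mor f"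
    if "cyl_homeo T T f g" for g
    unfolding mor_def using that by (intro rational_iff_finitary[OF ss]) (auto simp: cyl_homeo_def)
  then show ?thesis
    unfolding RT_def fin_homeo_def homeomorphic_map_bdry_iff[OF rt rt] using ts by blast
qed

lemma R2_iff_fin_homeo: "k \<in> R2 \<longleftrightarrow> (\<exists>g. fin_homeo UNIV bmor UNIV bmor k g)"
  unfolding R2_iff fin_homeo_def using B.tree_structure_axioms by blast

lemma group_RT:
  assumes ss: "self_similar T tp Mor" "branching T"
  shows "group (RT_group T tp Mor)"
proof -
  note iff = RT_iff[OF ss]
  have ts: "tree_structure T (tree_mor T tp Mor)" by (rule tree_structure_tree_mor[OF ss])
  have maps: "f p \<in> bdry T" if "f \<in> RT T tp Mor" "p \<in> bdry T" for f p
    using that unfolding iff fin_homeo_def cyl_homeo_def by blast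
  show ?thesis
  proof (rule groupI)
    fix f g assume "f \<in> carrier (RT_group T tp Mor)" "g \<in> carrier (RT_group T tp Mor)"
    then obtain f' g' where f: "fin_homeo T (tree_mor T tp Mor) T (tree_mor T tp Mor) f f'"
      and g: "fin_homeo T (tree_mor T tp Mor) T (tree_mor T tp Mor) g g'"
      by (auto simp: RT_group_def iff)
    have "fin_homeo T (tree_mor T tp Mor) T (tree_mor T tp Mor) (compose (bdry T) f g) (\<lambda>p. g' (f' p))"
      by (rule fin_homeo_cong[OF fin_homeo_comp[OF g f]]) (simp_all add: compose_def)
    then show "f \<otimes>\<^bsub>RT_group T tp Mor\<^esub> g \<in> carrier (RT_group T tp Mor)"
      unfolding RT_group_def using iff by (auto simp: compose_def)
  next
    have "fin_homeo T (tree_mor T tp Mor) T (tree_mor T tp Mor) (\<lambda>p. p) (\<lambda>p. p)"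
      unfolding fin_homeo_def using ts finitary_id[OF ts] cyl_homeo_id by blast
    then have "fin_homeo T (tree_mor T tp Mor) T (tree_mor T tp Mor) (restrict id (bdry T)) (\<lambda>p. p)"
      by (rule fin_homeo_cong) simp_all
    then show "\<one>\<^bsub>RT_group T tp Mor\<^esub> \<in> carrier (RT_group T tp Mor)"
      unfolding RT_group_def using iff by auto
  next
    fix f g k
    assume "f \<in> carrier (RT_group T tp Mor)" "g \<in> carrier (RT_group T tp Mor)"
      "k \<in> carrier (RT_group T tp Mor)"
    then show "f \<otimes>\<^bsub>RT_group T tp Mor\<^esub> g \<otimes>\<^bsub>RT_group T tp Mor\<^esub> k =
        f \<otimes>\<^bsub>RT_group T tp Mor\<^esub> (g \<otimes>\<^bsub>RT_group T tp Mor\<^esub> k)"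
      using maps by (auto simp: RT_group_def compose_def fun_eq_iff)
  next
    fix f assume "f \<in> carrier (RT_group T tp Mor)"
    then have f: "f \<in> RT T tp Mor" by (simp add: RT_group_def)
    then show "\<one>\<^bsub>RT_group T tp Mor\<^esub> \<otimes>\<^bsub>RT_group T tp Mor\<^esub> f = f"
      using maps[OF f] unfolding RT_def
      by (auto simp: RT_group_def compose_def fun_eq_iff extensional_def)
  next
    fix f assume "f \<in> carrier (RT_group T tp Mor)"
    then obtain g where g: "fin_homeo T (tree_mor T tp Mor) T (tree_mor T tp Mor) f g"
      by (auto simp: RT_group_def iff)
    \<comment> \<open>The inverse \<open>g\<close> is arbitrary off the boundary, whereas elements
      of \<open>RT\<close> are extensional.\<close>
    have "fin_homeo T (tree_mor T tp Mor) T (tree_mor T tp Mor) (restrict g (bdry T)) f"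
      by (rule fin_homeo_cong[OF fin_homeo_sym[OF g]]) simp_all
    then have "restrict g (bdry T) \<in> carrier (RT_group T tp Mor)"
      unfolding RT_group_def using iff by auto
    moreover have "restrict g (bdry T) \<otimes>\<^bsub>RT_group T tp Mor\<^esub> f = \<one>\<^bsub>RT_group T tp Mor\<^esub>"
      using g by (auto simp: RT_group_def compose_def fun_eq_iff fin_homeo_def cyl_homeo_def)
    ultimately show "\<exists>y\<in>carrier (RT_group T tp Mor). y \<otimes>\<^bsub>RT_group T tp Mor\<^esub> f = \<one>\<^bsub>RT_group T tp Mor\<^esub>"
      by blast
  qed
qed

text \<open>Conjugation composes three arrows of the groupoid, and conjugating back inverts it. The
  way back is restricted because maps in \<open>RT\<close> are extensional, while those in
  \<open>R2\<close> are total.\<close>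

lemma conjugation_bij_betw_RT_R2:
  assumes ss: "self_similar T tp Mor" "branching T"
    and h: "fin_homeo T (tree_mor T tp Mor) UNIV bmor h g"
  shows "bij_betw (\<lambda>f. h \<circ> f \<circ> g) (RT T tp Mor) R2"
proof (rule bij_betw_byWitness[where f' = "\<lambda>k. restrict (g \<circ> k \<circ> h) (bdry T)"])
  note iff = RT_iff[OF ss]
  have hg: "h (g z) = z" "g z \<in> bdry T" for z
    using h by (auto simp: fin_homeo_def cyl_homeo_def)
  have gh: "g (h p) = p" if "p \<in> bdry T" for p
    using h that by (auto simp: fin_homeo_def cyl_homeo_def)
  show "\<forall>f\<in>RT T tp Mor. restrict (g \<circ> (h \<circ> f \<circ> g) \<circ> h) (bdry T) = f"
  proof
    fix f assume f: "f \<in> RT T tp Mor"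
    then have "f p \<in> bdry T" if "p \<in> bdry T" for p
      using that unfolding iff fin_homeo_def cyl_homeo_def by blast
    then show "restrict (g \<circ> (h \<circ> f \<circ> g) \<circ> h) (bdry T) = f"
      using f gh by (intro extensionalityI[of _ "bdry T"]) (simp_all add: RT_def)
  qed
  show "\<forall>k\<in>R2. h \<circ> restrict (g \<circ> k \<circ> h) (bdry T) \<circ> g = k"
    by (simp add: fun_eq_iff hg)
  show "(\<lambda>f. h \<circ> f \<circ> g) ` RT T tp Mor \<subseteq> R2"
  proof (rule image_subsetI)
    fix f assume "f \<in> RT T tp Mor"
    then obtain f' where "fin_homeo T (tree_mor T tp Mor) T (tree_mor T tp Mor) f f'"
      unfolding iff by blast
    from fin_homeo_comp[OF fin_homeo_sym[OF h] fin_homeo_comp[OF this h]]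
    show "h \<circ> f \<circ> g \<in> R2" unfolding R2_iff_fin_homeo comp_def by blast
  qed
  show "(\<lambda>k. restrict (g \<circ> k \<circ> h) (bdry T)) ` R2 \<subseteq> RT T tp Mor"
  proof (rule image_subsetI)
    fix k assume "k \<in> R2"
    then obtain k' where "fin_homeo UNIV bmor UNIV bmor k k'"
      unfolding R2_iff_fin_homeo by blast
    from fin_homeo_comp[OF h fin_homeo_comp[OF this fin_homeo_sym[OF h]]]
    have "fin_homeo T (tree_mor T tp Mor) T (tree_mor T tp Mor) (\<lambda>p. g (k (h p))) (\<lambda>p. g (k' (h p)))" .
    then have "fin_homeo T (tree_mor T tp Mor) T (tree_mor T tp Mor)
        (restrict (g \<circ> k \<circ> h) (bdry T)) (\<lambda>p. g (k' (h p)))"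
      by (rule fin_homeo_cong) simp_all
    then show "restrict (g \<circ> k \<circ> h) (bdry T) \<in> RT T tp Mor" unfolding iff by auto
  qed
qed

theorem mainTheorem8:
  fixes T :: "'a list set" and tp :: "'a list \<Rightarrow> nat"
    and Mor :: "'a list \<Rightarrow> 'a list \<Rightarrow> ('a list \<Rightarrow> 'a list) set"
  assumes "self_similar T tp Mor" and "branching T"
  shows "group (RT_group T tp Mor) \<and> RT_group T tp Mor \<cong> R2_group \<and>
    (\<exists>h. homeomorphic_map (bdry_top T) cantor_top h \<and>
       bij_betw (\<lambda>f. h \<circ> f \<circ> inv_into (bdry T) h) (RT T tp Mor) R2)"
proof -
  have ts: "tree_structure T (tree_mor T tp Mor)"
    using assms by (rule tree_structure_tree_mor)
  then have rt: "rooted_tree T" by (rule tree_structure.rooted)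
  obtain h g where "cyl_homeo T UNIV h g"
      "tree_pair.finitary T (tree_mor T tp Mor) UNIV bmor h"
    using finitary_homeo_to_binary[OF ts] .
  then have h: "fin_homeo T (tree_mor T tp Mor) UNIV bmor h g"
    unfolding fin_homeo_def using ts B.tree_structure_axioms by blast
  have hg: "h (g z) = z" "g z \<in> bdry T" for z
    using h by (auto simp: fin_homeo_def cyl_homeo_def)
  have gh: "g (h p) = p" if "p \<in> bdry T" for p
    using h that by (auto simp: fin_homeo_def cyl_homeo_def)
  have "inv_into (bdry T) h z = g z" for z
    using h hg cyl_homeo_inj_on by (intro inv_into_f_eq) (auto simp: fin_homeo_def)
  then have inv: "inv_into (bdry T) h = g" ..
  have bij: "bij_betw (\<lambda>f. h \<circ> f \<circ> g) (RT T tp Mor) R2"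
    using assms h by (rule conjugation_bij_betw_RT_R2)
  \<comment> \<open>As \<open>g\<close> takes values in the boundary, the restriction hidden in
    \<open>compose\<close> is never met; \<open>k\<close> stays in the boundary, where the inner
    \<open>g\<close> and \<open>h\<close> cancel.\<close>
  have "h \<circ> compose (bdry T) f k \<circ> g = (h \<circ> f \<circ> g) \<circ> (h \<circ> k \<circ> g)"
    if k: "k \<in> RT T tp Mor" for f k
  proof
    fix z
    have "k (g z) \<in> bdry T"
      using k hg(2) unfolding RT_iff[OF assms] fin_homeo_def cyl_homeo_def by blast
    then show "(h \<circ> compose (bdry T) f k \<circ> g) z = ((h \<circ> f \<circ> g) \<circ> (h \<circ> k \<circ> g)) z"
      by (simp add: compose_def hg gh)
  qed
  then have "(\<lambda>f. h \<circ> f \<circ> g) \<in> iso (RT_group T tp Mor) R2_group"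
    using bij bij_betwE[OF bij] by (auto simp: iso_def hom_def RT_group_def R2_group_def)
  then have "RT_group T tp Mor \<cong> R2_group" by (rule is_isoI)
  moreover have "homeomorphic_map (bdry_top T) cantor_top h"
    using h unfolding cantor_top_def homeomorphic_map_bdry_iff[OF rt rooted_tree_UNIV] fin_homeo_def
    by blast
  ultimately show ?thesis
    using group_RT[OF assms] bij unfolding inv[symmetric] by blast
qed

end
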